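(* Let $\mathbb{F}$ be any field and let $U$ be a regular subgroup of $\mathrm{AGL}_3(\mathbb{F})$ such that $\delta_U$ is linear. Suppose $d(Z(U))=2$ and $r(Z(U))=1$, where $Z(U)$ is the center of $U$. If $U$ is abelian, then $U=S_{(2,1^2)}$, the translation subgroup $\left\{\begin{pmatrix}1&v\\0&I_3\end{pmatrix}:v\in\mathbb{F}^3\right\}$. Otherwise, $U$ is conjugate in $\mathrm{AGL}_3(\mathbb{F})$ to exactly one of the following subgroups ($x_1,x_2,x_3$ ranging over $\mathbb{F}$): (a) $N_1=\left\{\begin{pmatrix}1&x_1&x_2&x_3\\0&1&0&0\\0&0&1&x_1\\0&0&0&1\end{pmatrix}\right\}$, if $k(U)=2$; (b) $N_2=\left\{\begin{pmatrix}1&x_1&x_2&x_3\\0&1&0&-x_2\\0&0&1&x_1\\0&0&0&1\end{pmatrix}\right\}$, if $k(U)=1$, $d(U)=2$ and $\mathrm{char}\,\mathbb{F}\neq 2$; (c) $N_{3,\lambda}=\left\{\begin{pmatrix}1&x_1&x_2&x_3\\0&1&0&x_1+x_2\\0&0&1&\lambda x_2\\0&0&0&1\end{pmatrix}\right\}$, $\lambda\in\mathbb{F}^\ast$, if $k(U)=1$ and $d(U)=3$. The algebras $\mathcal{L}_1=\mathbb{F}I_4+N_1$, $\mathcal{L}_2=\mathbb{F}I_4+N_2$ and $\mathcal{L}_{3,\lambda}=\mathbb{F}I_4+N_{3,\lambda}$ have the following presentations as associative unital $\mathbb{F}$-algebras on two generators $t_1,t_2$: $\mathcal{L}_1$ has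 relations $t_1^2=t_2^2=t_1t_2=0$; $\mathcal{L}_2$ has relations $t_1^2=t_2^2=t_1t_2+t_2t_1=0$; $\mathcal{L}_{3,\lambda}$, for $\lambda\in\mathbb{F}^\ast$, has relations $t_2^2-\lambda t_1^2=t_2t_1=t_1^2-t_1t_2=0$.
   Context: $\mathrm{AGL}_n(\mathbb{F})$ is the subgroup of $\mathrm{GL}_{n+1}(\mathbb{F})$ consisting of the matrices with first column $(1,0,\dots,0)^{\mathrm T}$; $\pi:\mathrm{AGL}_n(\mathbb{F})\to\mathrm{GL}_n(\mathbb{F})$ sends $\begin{pmatrix}1&v\\0&A\end{pmatrix}$ to $A$. A subgroup $R\le\mathrm{AGL}_n(\mathbb{F})$ is regular if for every $v\in\mathbb{F}^n$ there is exactly one element of $R$ with first row $(1,v)$; this element is written $\begin{pmatrix}1&v\\0&I_n+\delta_R(v)\end{pmatrix}$, defining $\delta_R:\mathbb{F}^n\to\mathrm{Mat}_n(\mathbb{F})$; "linear" means $\mathbb{F}$-linear. Every regular subgroup with linear $\delta$ is unipotent. For a unipotent subgroup $H\le\mathrm{AGL}_n(\mathbb{F})$: $d(H)$ is the maximum over $h\in H$ of the degree of the minimal polynomial of $h-I_{n+1}$ over $\mathbb{F}$; $r(H)$ is the maximum over $h\in H$ of the rank of $h-I_{n+1}$; $k(H)=\dim_{\mathbb{F}}\{w\in\mathbb{F}^n: w\pi(h)=w\text{ for all }h\in H\}$. For a regular subgroup $N$ with $\delta_N$ linear, $\mathbb{F}I_{n+1}+N=\{\alpha I_{n+1}+\beta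 u:\alpha,\beta\in\mathbb{F},u\in N\}$ is a matrix algebra. *)

theory Defs
  imports
    "Jordan_Normal_Form.DL_Rank"
    "HOL-Algebra.QuotRing"
    "HOL-Library.Poly_Mapping"
begin

section \<open>Affine groups and regular subgroups\<close>

definition GL :: "nat \<Rightarrow> 'a::field mat monoid" where
  "GL m = units_of (ring_mat TYPE('a) m ())"

definition AGL :: "nat \<Rightarrow> 'a::field mat monoid" where
  "AGL n = GL (n + 1)\<lparr>carrier := {h \<in> carrier (GL (n + 1)). col h 0 = unit_vec (n + 1) 0}\<rparr>"

text \<open>The map \<open>\<pi>\<close>: deleting the first row and the first column leaves the linear part.\<close>

definition lin_part :: "'a mat \<Rightarrow> 'a mat" where
  "lin_part h = mat_delete h 0 0"

definition regular :: "nat \<Rightarrow> 'a::field mat set \<Rightarrow> bool" where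
  "regular n R \<longleftrightarrow> subgroup R (AGL n) \<and>
     (\<forall>v \<in> carrier_vec n. \<exists>!h. h \<in> R \<and> row h 0 = vCons 1 v)"

definition delta :: "nat \<Rightarrow> 'a::field mat set \<Rightarrow> 'a vec \<Rightarrow> 'a mat" where
  "delta n R v = lin_part (THE h. h \<in> R \<and> row h 0 = vCons 1 v) - 1\<^sub>m n"

definition delta_linear :: "nat \<Rightarrow> 'a::field mat set \<Rightarrow> bool" where
  "delta_linear n R \<longleftrightarrow>
     linear_map class_ring (module_vec TYPE('a) n) (module_mat TYPE('a) n n) (delta n R)"

definition center :: "nat \<Rightarrow> 'a::field mat set \<Rightarrow> 'a mat set" where
  "center n U = {z \<in> U. \<forall>u \<in> U. z \<otimes>\<^bsub>AGL n\<^esub> u = u \<otimes>\<^bsub>AGL n\<^esub> z}"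

definition abelian :: "nat \<Rightarrow> 'a::field mat set \<Rightarrow> bool" where
  "abelian n U \<longleftrightarrow> comm_group (AGL n\<lparr>carrier := U\<rparr>)"

definition AGL_conj :: "nat \<Rightarrow> 'a::field mat set \<Rightarrow> 'a mat set \<Rightarrow> bool" where
  "AGL_conj n U M \<longleftrightarrow>
     (\<exists>g \<in> carrier (AGL n). M = (\<lambda>u. g \<otimes>\<^bsub>AGL n\<^esub> u \<otimes>\<^bsub>AGL n\<^esub> inv\<^bsub>AGL n\<^esub> g) ` U)"

section \<open>The invariants $d$, $r$ and $k$\<close>

definition poly_mat :: "'a::field poly \<Rightarrow> 'a mat \<Rightarrow> 'a mat" where
  "poly_mat p A = mat (dim_row A) (dim_row A)
     (\<lambda>(i, j). \<Sum>l \<le> degree p. coeff p l * (A ^\<^sub>m l) $$ (i, j))"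

definition min_poly :: "'a::field mat \<Rightarrow> 'a poly" where
  "min_poly A = (THE p. lead_coeff p = 1 \<and> poly_mat p A = 0\<^sub>m (dim_row A) (dim_row A) \<and>
     (\<forall>q. q \<noteq> 0 \<and> poly_mat q A = 0\<^sub>m (dim_row A) (dim_row A) \<longrightarrow> degree p \<le> degree q))"

definition max_deg :: "nat \<Rightarrow> 'a::field mat set \<Rightarrow> nat" where
  "max_deg n H = Max ((\<lambda>h. degree (min_poly (h - 1\<^sub>m (n + 1)))) ` H)"

definition max_rank :: "nat \<Rightarrow> 'a::field mat set \<Rightarrow> nat" where
  "max_rank n H = Max ((\<lambda>h. vec_space.rank (n + 1) (h - 1\<^sub>m (n + 1))) ` H)"

text \<open>Vectors of $F^n$ are row vectors, on which matrices act from the right.\<close>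

definition fix_space :: "nat \<Rightarrow> 'a::field mat set \<Rightarrow> 'a vec set" where
  "fix_space n H = {w \<in> carrier_vec n. \<forall>h \<in> H. mat_of_row w * lin_part h = mat_of_row w}"

definition fix_dim :: "nat \<Rightarrow> 'a::field mat set \<Rightarrow> nat" where
  "fix_dim n H = vectorspace.dim class_ring (module_vec TYPE('a) n\<lparr>carrier := fix_space n H\<rparr>)"

section \<open>The representatives\<close>

definition translation_subgroup :: "nat \<Rightarrow> 'a::field mat set" where
  "translation_subgroup n =
     {four_block_mat (1\<^sub>m 1) (mat_of_row v) (0\<^sub>m n 1) (1\<^sub>m n) | v. v \<in> carrier_vec n}"

definition N1 :: "'a::field mat set" where
  "N1 = {mat_of_rows_list 4
     [[1, x1, x2, x3],
      [0, 1,  0,  0 ],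
      [0, 0,  1,  x1],
      [0, 0,  0,  1 ]] | x1 x2 x3. True}"

definition N2 :: "'a::field mat set" where
  "N2 = {mat_of_rows_list 4
     [[1, x1, x2, x3],
      [0, 1,  0,  - x2],
      [0, 0,  1,  x1],
      [0, 0,  0,  1 ]] | x1 x2 x3. True}"

definition N3 :: "'a::field \<Rightarrow> 'a mat set" where
  "N3 l = {mat_of_rows_list 4
     [[1, x1, x2, x3],
      [0, 1,  0,  x1 + x2],
      [0, 0,  1,  l * x2],
      [0, 0,  0,  1 ]] | x1 x2 x3. True}"

definition alg_of :: "nat \<Rightarrow> 'a::field mat set \<Rightarrow> 'a mat set" where
  "alg_of n N = {\<alpha> \<cdot>\<^sub>m 1\<^sub>m (n + 1) + \<beta> \<cdot>\<^sub>m u | \<alpha> \<beta> u. u \<in> N}"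

section \<open>Presentations of associative unital algebras\<close>

text \<open>The free monoid is written additively, since the product of \<^typ>\<open>'m::monoid_add \<Rightarrow>\<^sub>0 'a::semiring_0\<close>
  is the convolution product of the monoid algebra. Hence \<^typ>\<open>'m \<Rightarrow>\<^sub>0 'a\<close> for the free monoid
  on \<open>'g\<close> is the free associative unital algebra on \<open>'g\<close>.\<close>

datatype 'g free_mon = FreeMon (letters: "'g list")

instantiation free_mon :: (type) monoid_add
begin

definition zero_free_mon :: "'a free_mon" where
  "0 = FreeMon []"

definition plus_free_mon :: "'a free_mon \<Rightarrow> 'a free_mon \<Rightarrow> 'a free_mon" where
  "v + w = FreeMon (letters v @ letters w)"

instance
  by standard (simp_all add: zero_free_mon_def plus_free_mon_def)

end

type_synonym ('g, 'a) free_alg = "'g free_mon \<Rightarrow>\<^sub>0 'a"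

definition gen :: "'g \<Rightarrow> ('g, 'a::field) free_alg" where
  "gen g = Poly_Mapping.single (FreeMon [g]) 1"

definition scal :: "'a::field \<Rightarrow> ('g, 'a) free_alg" where
  "scal c = Poly_Mapping.single 0 c"

text \<open>The matrix algebra \<open>L\<close>, whose elements are square of size \<open>m\<close>, is isomorphic as a unital
  algebra to the free algebra on \<open>'g\<close> modulo the two-sided ideal generated by \<open>S\<close>. The last
  condition makes the ring isomorphism linear.\<close>

definition has_presentation :: "nat \<Rightarrow> 'a::field mat set \<Rightarrow> ('g, 'a) free_alg set \<Rightarrow> bool" where
  "has_presentation m L S \<longleftrightarrow>
     (let R = (class_ring :: ('g, 'a) free_alg ring); I = genideal R S in
      \<exists>f \<in> ring_iso (R Quot I) (ring_mat TYPE('a) m ()\<lparr>carrier := L\<rparr>).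
        \<forall>c p. f (I +>\<^bsub>R\<^esub> (scal c * p)) = c \<cdot>\<^sub>m f (I +>\<^bsub>R\<^esub> p))"

datatype two_gens = T1 | T2

abbreviation t1 :: "(two_gens, 'a::field) free_alg" where "t1 \<equiv> gen T1"
abbreviation t2 :: "(two_gens, 'a::field) free_alg" where "t2 \<equiv> gen T2"

end

theory Submission
  imports
    Defs
    "HOL-Library.Product_Plus"
    "Jordan_Normal_Form.DL_Rank_Submatrix"
begin

text \<open>A regular subgroup \<open>U\<close> with linear \<open>\<delta>\<close> is the same as an associative product \<open>x \<cdot> v = x \<delta>(v)\<close> on
  \<open>F\<^sup>3\<close> in which \<open>x + x \<cdot> v = 0\<close> forces \<open>x = 0\<close>. The latter makes \<open>x, x y, x y z, x y z w\<close> linearly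
  independent as soon as the last of them is not \<open>0\<close>, so products of four elements vanish; and if
  \<open>x y z \<noteq> 0\<close> then \<open>x\<close> generates the algebra. Hence in a noncommutative algebra products of three
  elements vanish, and the product is a bilinear form on a plane, not symmetric, with values in the
  annihilator, which is a line. Conjugacy in the affine group is isomorphism of algebras, that is, equivalence of forms
  up to a scalar. A form of rank one gives \<open>N1\<close>, a nondegenerate alternating form gives \<open>N2\<close>, and otherwise
  a basis \<open>v, w\<close> with \<open>w v = 0\<close> and \<open>v w = v v\<close> gives \<open>N3 l\<close>, where \<open>l\<close> is recovered from the
  determinant. In the commutative case, rank one forces \<open>x \<cdot> v\<close> to be a multiple of \<open>v\<close>, hence \<open>0\<close>.\<close>

section \<open>Nilpotent algebra structures on $F^3$\<close>

text \<open>Quasiregularity is the invertibility of linear parts: the element with first row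
  \<open>(1, v)\<close> sends a row \<open>x\<close> to \<open>x + mul x v\<close>. It rules out
  eigenvectors of right multiplications for nonzero eigenvalues, which is why linear relations along
  a chain of products die coefficient by coefficient from the left. The invariants are read off the
  form. Rows fixed by all linear parts make up the left annihilator, so k is one more than the
  dimension of the left kernel of the form: 2 in rank one, 1 for a nondegenerate form. The square of
  \<open>h - 1\<close> keeps only \<open>mul v v\<close>, in its first row, and the cube is 0; so d
  is 3 exactly when some square is nonzero, that is, when the form is not alternating. An
  alternating form in characteristic 2 is symmetric, which noncommutativity forbids. So the types
  exclude each other, and elimination turns this into equivalences. For the presentations, the
  unital algebra has as basis 1, the two generators and one product of generators; the relations
  must rewrite every word into this span.\<close>

type_synonym 'a triple = "'a \<times> 'a \<times> 'a"

definition scl :: "'a::field \<Rightarrow> 'a triple \<Rightarrow> 'a triple" where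
  "scl c v = (c * fst v, c * fst (snd v), c * snd (snd v))"

lemma scl_Pair [simp]: "scl c (x, y, z) = (c * x, c * y, c * z)"
  by (simp add: scl_def)

interpretation triple: vector_space scl
  by unfold_locales (auto simp: algebra_simps)

text \<open>This is the row \<open>x\<close> times the matrix with rows \<open>p\<close>,
  \<open>q\<close>, \<open>r\<close>; it serves for matrix products as well as for coordinates in a
  basis.\<close>

definition lc :: "'a::field triple \<Rightarrow> 'a triple \<Rightarrow> 'a triple \<Rightarrow> 'a triple \<Rightarrow> 'a triple" where
  "lc x p q r = scl (fst x) p + scl (fst (snd x)) q + scl (snd (snd x)) r"

lemma lc_Pair: "lc (a, b, c) p q r = scl a p + scl b q + scl c r"
  by (simp add: lc_def)

definition indep :: "'a::field triple \<Rightarrow> 'a triple \<Rightarrow> 'a triple \<Rightarrow> bool" where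
  "indep p q r \<longleftrightarrow> (\<forall>a b c. scl a p + scl b q + scl c r = 0 \<longrightarrow> a = 0 \<and> b = 0 \<and> c = 0)"

lemma indepI:
  assumes "\<And>a b c. scl a p + scl b q + scl c r = 0 \<Longrightarrow> a = 0 \<and> b = 0 \<and> c = 0"
  shows "indep p q r"
  unfolding indep_def by (intro allI impI assms)

lemma indepD:
  assumes "indep p q r" "scl a p + scl b q + scl c r = 0"
  shows "a = 0 \<and> b = 0 \<and> c = 0"
  using assms unfolding indep_def by blast

lemma det_nonzero_inverse:
  assumes A: "A \<in> carrier_mat n n" and d: "det (A :: 'a::field mat) \<noteq> 0"
  obtains B where "B \<in> carrier_mat n n" "A * B = 1\<^sub>m n"
proof -
  interpret R: ring "ring_mat TYPE('a) n ()" by (rule ring_mat)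
  have "A \<in> Units (ring_mat TYPE('a) n ())"
    by (rule det_non_zero_imp_unit[OF A d])
  from R.Units_r_inv_ex[OF this] have "\<exists>y\<in>carrier_mat n n. A * y = 1\<^sub>m n"
    by (simp only: ring_mat_simps)
  then show thesis
    by (elim bexE) (rule that)
qed

text \<open>Independence means that the matrix with columns \<open>p\<close>, \<open>q\<close>,
  \<open>r\<close> has trivial kernel. Its determinant is then nonzero, and a right inverse solves
  for the coefficients.\<close>

lemma indep_span:
  assumes ind: "indep p q r"
  obtains a b c where "v = scl a p + scl b q + scl c r"
proof -
  obtain p1 p2 p3 q1 q2 q3 r1 r2 r3 v1 v2 v3
    where e: "p = (p1, p2, p3)" "q = (q1, q2, q3)" "r = (r1, r2, r3)" "v = (v1, v2, v3)"
    by (metis prod.collapse)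
  define A where "A = mat 3 3 (\<lambda>(i, j). [[p1, q1, r1], [p2, q2, r2], [p3, q3, r3]] ! i ! j)"
  have A: "A \<in> carrier_mat 3 3"
    by (simp add: A_def)
  have Av: "A *\<^sub>v w = vec_of_list [w$0*p1+w$1*q1+w$2*r1, w$0*p2+w$1*q2+w$2*r2, w$0*p3+w$1*q3+w$2*r3]"
    if "w \<in> carrier_vec 3" for w
  proof (rule eq_vecI)
    fix i assume "i < dim_vec (vec_of_list [w$0*p1+w$1*q1+w$2*r1, w$0*p2+w$1*q2+w$2*r2, w$0*p3+w$1*q3+w$2*r3])"
    then have "i = 0 \<or> i = 1 \<or> i = 2" by auto
    then show "(A *\<^sub>v w) $ i = vec_of_list [w$0*p1+w$1*q1+w$2*r1, w$0*p2+w$1*q2+w$2*r2, w$0*p3+w$1*q3+w$2*r3] $ i"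
      using that by (auto simp: A_def scalar_prod_def numeral_3_eq_3 numeral_2_eq_2 mult.commute)
  qed (use A in auto)
  have "det A \<noteq> 0"
  proof
    assume "det A = 0"
    then obtain w where w: "w \<in> carrier_vec 3" "w \<noteq> 0\<^sub>v 3" "A *\<^sub>v w = 0\<^sub>v 3"
      using det_0_iff_vec_prod_zero_field[OF A] by auto
    have "(A *\<^sub>v w) $ 0 = 0" "(A *\<^sub>v w) $ 1 = 0" "(A *\<^sub>v w) $ 2 = 0"
      using w(3) by auto
    then have "w$0*p1+w$1*q1+w$2*r1 = 0" "w$0*p2+w$1*q2+w$2*r2 = 0" "w$0*p3+w$1*q3+w$2*r3 = 0"
      unfolding Av[OF w(1)] by (auto simp: numeral_2_eq_2)
    then have "scl (w$0) p + scl (w$1) q + scl (w$2) r = 0"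
      by (simp add: e zero_prod_def)
    then have "w$0 = 0" "w$1 = 0" "w$2 = 0" using indepD[OF ind] by auto
    then have "w = 0\<^sub>v 3"
      using w(1) by (intro eq_vecI) (auto simp: less_Suc_eq numeral_3_eq_3 numeral_2_eq_2)
    then show False using w by simp
  qed
  then obtain B where BA: "B \<in> carrier_mat 3 3" "A * B = 1\<^sub>m 3"
    by (rule det_nonzero_inverse[OF A])
  define w where "w = B *\<^sub>v vec_of_list [v1, v2, v3]"
  have vc: "vec_of_list [v1, v2, v3] \<in> carrier_vec 3"
    by (rule carrier_vecI) simp
  have w: "w \<in> carrier_vec 3" using BA vc by (auto simp: w_def)
  have "A *\<^sub>v w = vec_of_list [v1, v2, v3]"
    unfolding w_def using A BA vc by (metis assoc_mult_mat_vec one_mult_mat_vec)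
  then have "[w$0*p1+w$1*q1+w$2*r1, w$0*p2+w$1*q2+w$2*r2, w$0*p3+w$1*q3+w$2*r3] = [v1, v2, v3]"
    unfolding Av[OF w] by (metis list_vec)
  then have "v = scl (w$0) p + scl (w$1) q + scl (w$2) r"
    unfolding e by simp
  then show thesis by (rule that)
qed

section \<open>Associative products on triples, quasiregularity and nilpotency\<close>

locale triple_algebra =
  fixes mul :: "'a::field triple \<Rightarrow> 'a triple \<Rightarrow> 'a triple"
  assumes add_left: "mul (v + v') w = mul v w + mul v' w"
    and add_right: "mul v (w + w') = mul v w + mul v w'"
    and scl_left: "mul (scl c v) w = scl c (mul v w)"
    and scl_right: "mul v (scl c w) = scl c (mul v w)"
    and assoc: "mul (mul u v) w = mul u (mul v w)"
begin

lemma zero_left [simp]: "mul 0 w = 0"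
  using add_left[of 0 0 w] by simp

lemma zero_right [simp]: "mul v 0 = 0"
  using add_right[of v 0 0] by simp

lemma minus_left: "mul (- v) w = - mul v w"
  using scl_left[of "-1" v w] by (simp add: triple.scale_minus_left)

lemma minus_right: "mul v (- w) = - mul v w"
  using scl_right[of v "-1" w] by (simp add: triple.scale_minus_left)

lemma diff_left: "mul (v - v') w = mul v w - mul v' w"
  using add_left[of v "- v'" w] by (simp add: minus_left)

lemma diff_right: "mul v (w - w') = mul v w - mul v w'"
  using add_right[of v w "- w'"] by (simp add: minus_right)

lemmas bilin = add_left add_right scl_left scl_right

end

locale quasiregular_algebra = triple_algebra +
  assumes quasiregular: "v + mul v w = 0 \<Longrightarrow> v = 0"
begin

text \<open>Replacing \<open>w\<close> by \<open>- w / c\<close> turns the eigenvector equation into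
  the quasiregularity equation.\<close>

lemma no_eigenvector:
  assumes "scl c v = mul v w" "c \<noteq> 0"
  shows "v = 0"
proof (rule quasiregular)
  show "v + mul v (scl (- inverse c) w) = 0"
    using assms(2) by (simp add: scl_right triple.scale_minus_left minus_right flip: assms(1))
qed

text \<open>In a relation, all terms after the leading one are right multiples of it, so the leading
  vector would be an eigenvector unless its coefficient is 0. This removes \<open>a\<close> and then
  \<open>b\<close>.\<close>

lemma chain_indep:
  assumes "mul (mul x y) z \<noteq> 0"
  shows "indep x (mul x y) (mul (mul x y) z)"
proof (rule indepI)
  fix a b c assume 0: "scl a x + scl b (mul x y) + scl c (mul (mul x y) z) = 0"
  have nz: "x \<noteq> 0" "mul x y \<noteq> 0" using assms by auto
  have "scl a x = mul x (- (scl b y + scl c (mul y z)))"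
    using 0 unfolding minus_right bilin assoc eq_neg_iff_add_eq_0 by (simp add: add.assoc)
  then have a: "a = 0" using no_eigenvector nz by blast
  have "scl b (mul x y) = mul (mul x y) (- (scl c z))"
    using 0 a unfolding minus_right bilin eq_neg_iff_add_eq_0 by simp
  then have b: "b = 0" using no_eigenvector nz by blast
  show "a = 0 \<and> b = 0 \<and> c = 0" using 0 a b assms by simp
qed

text \<open>The chain up to the third product is a basis. Expanding the fourth product in it, the
  eigenvector argument applies to each coefficient in turn, as the fourth product is itself a right
  multiple of every basis vector.\<close>

lemma nilpotent: "mul (mul (mul x y) z) w = 0"
proof (rule ccontr)
  assume nz: "mul (mul (mul x y) z) w \<noteq> 0"
  then have nz': "mul (mul x y) z \<noteq> 0" "mul x y \<noteq> 0" "x \<noteq> 0" by auto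
  obtain a b c where e: "mul (mul (mul x y) z) w = scl a x + scl b (mul x y) + scl c (mul (mul x y) z)"
    using indep_span[OF chain_indep[OF nz'(1)]] by metis
  have "scl a x = mul x (mul (mul y z) w - (scl b y + scl c (mul y z)))"
    using e unfolding diff_right bilin assoc by (simp add: eq_diff_eq add.assoc)
  then have a: "a = 0" using no_eigenvector nz' by blast
  have "scl b (mul x y) = mul (mul x y) (mul z w - scl c z)"
    using e a unfolding diff_right bilin assoc by (simp add: eq_diff_eq)
  then have b: "b = 0" using no_eigenvector nz' by blast
  have "scl c (mul (mul x y) z) = mul (mul (mul x y) z) w" using e a b by simp
  then have "c = 0" using no_eigenvector nz' by blast
  then show False using e a b nz by simp
qed

text \<open>A product \<open>x y z \<noteq> 0\<close> makes \<open>x\<close> a generator of the algebra, which is then commutative.\<close>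

lemma nilpotent_noncommutative:
  assumes nc: "mul s t \<noteq> mul t s"
  shows "mul (mul x y) z = 0"
proof (rule ccontr)
  assume nz: "mul (mul x y) z \<noteq> 0"
  note nil = nilpotent[unfolded assoc]
  note basis = chain_indep[OF nz]
  obtain a b c where y: "y = scl a x + scl b (mul x y) + scl c (mul (mul x y) z)"
    using indep_span[OF basis] .
  obtain a' b' c' where z: "z = scl a' x + scl b' (mul x y) + scl c' (mul (mul x y) z)"
    using indep_span[OF basis] .
  \<comment> \<open>Products of four elements vanish, so only the \<open>x\<close> components of
    \<open>y\<close> and \<open>z\<close> matter: the given product is a multiple of the cube of
    \<open>x\<close>. Hence \<open>x\<close>, its square and its cube form a basis.\<close>
  have "mul (mul x y) z = scl a (mul x (mul x z))"
    by (subst y) (simp add: bilin assoc nil)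
  also have "mul x (mul x z) = scl a' (mul x (mul x x))"
    by (subst z) (simp add: bilin assoc nil)
  finally have x3: "mul (mul x x) x \<noteq> 0" using nz by (auto simp: assoc)
  have "mul s t = mul t s"
  proof -
    obtain a b c where s: "s = scl a x + scl b (mul x x) + scl c (mul (mul x x) x)"
      using indep_span[OF chain_indep[OF x3]] .
    obtain a' b' c' where t: "t = scl a' x + scl b' (mul x x) + scl c' (mul (mul x x) x)"
      using indep_span[OF chain_indep[OF x3]] .
    show ?thesis unfolding s t
      by (simp add: bilin assoc nil algebra_simps)
  qed
  then show False using nc by simp
qed

end

section \<open>Products given by a bilinear form with Gram matrix \<open>(b11 b12; b21 b22)\<close>,
  and their normal forms\<close>

definition form_basis :: "('a::field triple \<Rightarrow> 'a triple \<Rightarrow> 'a triple) \<Rightarrow> 'a \<Rightarrow> 'a \<Rightarrow> 'a \<Rightarrow> 'a \<Rightarrow>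
    'a triple \<Rightarrow> 'a triple \<Rightarrow> 'a triple \<Rightarrow> bool" where
  "form_basis mul b11 b12 b21 b22 p q r \<longleftrightarrow> indep p q r \<and>
     mul p p = scl b11 r \<and> mul p q = scl b12 r \<and> mul q p = scl b21 r \<and> mul q q = scl b22 r \<and>
     (\<forall>v. mul r v = 0 \<and> mul v r = 0)"

context quasiregular_algebra
begin

text \<open>The commutator of \<open>x\<close> and \<open>y\<close> is annihilated from both sides
  because products of three elements vanish. As third basis vector it forces
  \<open>b12 - b21 = 1\<close>, a normalization that the normal form relies on.\<close>

lemma noncommutative_form_basis:
  assumes nc: "mul x y \<noteq> mul y x"
  shows "\<exists>b11 b12 b21 b22. b12 - b21 = 1 \<and> form_basis mul b11 b12 b21 b22 x y (mul x y - mul y x)"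
proof -
  note nil = nilpotent_noncommutative[OF nc, unfolded assoc]
  define c where "c = mul x y - mul y x"
  have c0: "c \<noteq> 0" using nc by (simp add: c_def)
  have cN: "mul c v = 0" "mul v c = 0" for v
    by (simp_all add: c_def diff_left diff_right assoc nil)
  \<comment> \<open>Comparing \<open>mul w x\<close> with \<open>mul x w\<close> shows that
    \<open>b\<close> times the commutator is 0; comparing \<open>mul w y\<close> with
    \<open>mul y w\<close> does the same for \<open>a\<close>.\<close>
  have lin: "a = 0 \<and> b = 0" if e: "scl a x + scl b y = w"
    and w: "mul w x = 0" "mul x w = 0" "mul w y = 0" "mul y w = 0" for a b w
  proof -
    have "scl b (mul x y) = scl b (mul y x)" "scl a (mul x y) = scl a (mul y x)"
      using w unfolding e[symmetric] bilin by (metis add_left_cancel, metis add_right_cancel)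
    then show ?thesis using nc by (metis triple.scale_cancel_left)
  qed
  have ind: "indep x y c"
  proof (rule indepI)
    fix a b d assume 0: "scl a x + scl b y + scl d c = 0"
    then have "scl a x + scl b y = - scl d c" by (simp add: add_eq_0_iff2)
    from lin[OF this] have "a = 0 \<and> b = 0"
      by (simp add: minus_left minus_right bilin cN)
    then show "a = 0 \<and> b = 0 \<and> d = 0" using 0 c0 by simp
  qed
  \<comment> \<open>Products and \<open>c\<close> annihilate everything, so \<open>lin\<close>
    removes the \<open>x\<close> and \<open>y\<close> components of a product.\<close>
  have line: "\<exists>d. mul v w = scl d c" for v w
  proof -
    obtain a b d where e: "mul v w = scl a x + scl b y + scl d c"
      using indep_span[OF ind] .
    then have "scl a x + scl b y = mul v w + scl (- d) c"
      by (simp add: triple.scale_minus_left)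
    from lin[OF this] have "a = 0 \<and> b = 0"
      by (simp add: diff_left diff_right bilin assoc nil cN)
    then show ?thesis using e by auto
  qed
  obtain b11 b12 b21 b22 where b: "mul x x = scl b11 c" "mul x y = scl b12 c" "mul y x = scl b21 c" "mul y y = scl b22 c"
    using line by metis
  have "scl (b12 - b21) c = scl 1 c"
    unfolding triple.scale_left_diff_distrib b(2,3)[symmetric] by (simp add: c_def)
  then have "b12 - b21 = 1" by (rule triple.scale_right_imp_eq[OF c0])
  then show ?thesis
    unfolding c_def[symmetric]
    by (intro exI[of _ b11] exI[of _ b12] exI[of _ b21] exI[of _ b22])
      (simp add: form_basis_def ind b cN)
qed

end

context triple_algebra
begin

lemma form_basis_mul:
  assumes "form_basis mul b11 b12 b21 b22 p q r"
  shows "mul (scl a p + scl b q + scl c r) (scl a' p + scl b' q + scl c' r) =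
    scl (a * (b11 * a' + b12 * b') + b * (b21 * a' + b22 * b')) r"
proof -
  have "mul r v = 0" "mul v r = 0" for v using assms unfolding form_basis_def by blast+
  then show ?thesis
    using assms unfolding form_basis_def
    by (simp add: bilin triple.scale_left_distrib triple.scale_right_distrib distrib_left ac_simps
        del: split_paired_All)
qed

text \<open>The four equations say that P B P^T = s C for the matrix P with rows
  \<open>(\<alpha>, \<beta>)\<close> and \<open>(\<gamma>, \<delta>)\<close> and the two Gram
  matrices B and C. Rescaling \<open>r\<close> by \<open>s\<close> absorbs the factor.\<close>

lemma form_basis_change:
  assumes fb: "form_basis mul b11 b12 b21 b22 p q r"
    and det: "\<alpha> * \<delta> - \<beta> * \<gamma> \<noteq> 0" and s: "s \<noteq> 0"
    and c: "\<alpha> * (b11 * \<alpha> + b12 * \<beta>) + \<beta> * (b21 * \<alpha> + b22 * \<beta>) = s * c11"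
      "\<alpha> * (b11 * \<gamma> + b12 * \<delta>) + \<beta> * (b21 * \<gamma> + b22 * \<delta>) = s * c12"
      "\<gamma> * (b11 * \<alpha> + b12 * \<beta>) + \<delta> * (b21 * \<alpha> + b22 * \<beta>) = s * c21"
      "\<gamma> * (b11 * \<gamma> + b12 * \<delta>) + \<delta> * (b21 * \<gamma> + b22 * \<delta>) = s * c22"
  shows "form_basis mul c11 c12 c21 c22 (scl \<alpha> p + scl \<beta> q) (scl \<gamma> p + scl \<delta> q) (scl s r)"
proof -
  have ind: "indep p q r" using fb by (simp add: form_basis_def)
  have "indep (scl \<alpha> p + scl \<beta> q) (scl \<gamma> p + scl \<delta> q) (scl s r)"
  proof (rule indepI)
    fix x y z assume "scl x (scl \<alpha> p + scl \<beta> q) + scl y (scl \<gamma> p + scl \<delta> q) + scl z (scl s r) = 0"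
    then have "scl (x * \<alpha> + y * \<gamma>) p + scl (x * \<beta> + y * \<delta>) q + scl (z * s) r = 0"
      by (simp add: triple.scale_right_distrib triple.scale_left_distrib add.assoc add.left_commute)
    from indepD[OF ind this] have *: "x * \<alpha> + y * \<gamma> = 0" "x * \<beta> + y * \<delta> = 0" "z = 0" using s by auto
    have "x * (\<alpha> * \<delta> - \<beta> * \<gamma>) = (x * \<alpha> + y * \<gamma>) * \<delta> - (x * \<beta> + y * \<delta>) * \<gamma>"
      "y * (\<alpha> * \<delta> - \<beta> * \<gamma>) = (x * \<beta> + y * \<delta>) * \<alpha> - (x * \<alpha> + y * \<gamma>) * \<beta>"
      by (simp_all add: algebra_simps)
    then show "x = 0 \<and> y = 0 \<and> z = 0" using * det by simp
  qed
  moreover have *: "mul (scl x p + scl y q) (scl x' p + scl y' q) =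
      scl (x * (b11 * x' + b12 * y') + y * (b21 * x' + b22 * y')) r" for x y x' y'
    using form_basis_mul[OF fb, of x y 0 x' y' 0] by simp
  moreover have "mul (scl s r) v = 0" "mul v (scl s r) = 0" for v
    using fb unfolding form_basis_def by (simp_all add: bilin del: split_paired_All)
  ultimately show ?thesis
    unfolding form_basis_def
    by (simp only: * c triple.scale_scale mult.commute[of s] simp_thms)
qed

text \<open>The quotient of the determinant of the form by the square of \<open>b12 - b21\<close> depends neither on the basis
  nor on the choice of \<open>r\<close>; its value for the form below is \<open>l\<close>.\<close>

lemma form_basis_invariant:
  assumes l: "form_basis mul 1 1 0 l p q r" and m: "form_basis mul 1 1 0 m p' q' r'"
  shows "l = m"
proof -
  have ind: "indep p q r" using l by (simp add: form_basis_def)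
  obtain a b e where p': "p' = scl a p + scl b q + scl e r" using indep_span[OF ind] .
  obtain c d f where q': "q' = scl c p + scl d q + scl f r" using indep_span[OF ind] .
  note mult = form_basis_mul[OF l, simplified]
  define s where "s = a * (a + b) + b * (l * b)"
  have r': "r' = scl s r"
    using m unfolding form_basis_def p' q' mult s_def by simp
  have nz: "indep p' q' r'" using m by (simp add: form_basis_def)
  have "r' \<noteq> 0" using indepD[OF nz, of 0 0 1] by auto
  then have r0: "r \<noteq> 0" "s \<noteq> 0" unfolding r' by auto
  have "scl (a * (c + d) + b * (l * d)) r = scl s r" "scl (c * (a + b) + d * (l * b)) r = scl 0 r"
    "scl (c * (c + d) + d * (l * d)) r = scl (m * s) r"
    using m unfolding form_basis_def p' q' mult r' by auto
  then have e: "a * (c + d) + b * (l * d) = s" "c * (a + b) + d * (l * b) = 0"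
    "c * (c + d) + d * (l * d) = m * s"
    using r0 by auto
  \<comment> \<open>The new mixed products have coefficients \<open>s\<close> and 0, and a change of
    basis multiplies the difference of the mixed entries, here 1, by its determinant.\<close>
  have "s = (a * (c + d) + b * (l * d)) - (c * (a + b) + d * (l * b))" using e by simp
  also have "\<dots> = a * d - b * c" by (simp add: algebra_simps)
  finally have s: "s = a * d - b * c" .
  \<comment> \<open>This is the determinant rule det (P B P^T) = det B * (det P)^2, with the product
    of the mixed entries moved to the right. Substitution gives
    \<open>s * (m * s) = l * s^2\<close>.\<close>
  have "(a * (a + b) + b * (l * b)) * (c * (c + d) + d * (l * d)) =
      l * (a * d - b * c)\<^sup>2 + (a * (c + d) + b * (l * d)) * (c * (a + b) + d * (l * b))"
    by (simp add: algebra_simps power2_eq_square)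
  then have "(l - m) * s\<^sup>2 = 0"
    unfolding e s_def[symmetric] s[symmetric] by (auto simp: algebra_simps power2_eq_square)
  then show ?thesis using r0 by simp
qed

end

context quasiregular_algebra
begin

text \<open>Either the form is alternating, hence a multiple of the one for \<open>N2\<close>, or
  some vector has nonzero square and together with its left orthogonal gives the Gram matrix
  \<open>(1 1; 0 l)\<close>. Rank one is the case \<open>l = 0\<close> of the latter.\<close>

lemma normal_form:
  assumes nc: "mul x y \<noteq> mul y x"
  shows "\<exists>p q r. form_basis mul 0 0 1 0 p q r \<or> form_basis mul 0 (- 1) 1 0 p q r \<or>
    (\<exists>l. l \<noteq> 0 \<and> form_basis mul 1 1 0 l p q r)"
proof -
  obtain p q r b11 b12 b21 b22 where b: "b12 - b21 = 1" and fb: "form_basis mul b11 b12 b21 b22 p q r"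
    using noncommutative_form_basis[OF nc] by blast
  show ?thesis
  \<comment> \<open>The condition says that all squares vanish: the square of a vector is a
    quadratic form with coefficients \<open>b11\<close>, \<open>b12 + b21\<close> and
    \<open>b22\<close>.\<close>
  proof (cases "b11 = 0 \<and> b22 = 0 \<and> b12 + b21 = 0")
    case True
    then have "b12 = - b21" by (simp add: eq_neg_iff_add_eq_0)
    moreover from this have "b21 \<noteq> 0" using b by auto
    ultimately have "form_basis mul 0 (- 1) 1 0 (scl 1 p + scl 0 q) (scl 0 p + scl 1 q) (scl b21 r)"
      using True by (intro form_basis_change[OF fb]) auto
    then show ?thesis by blast
  next
    case False
    have "\<exists>\<alpha> \<beta>. \<alpha> * (b11 * \<alpha> + b12 * \<beta>) + \<beta> * (b21 * \<alpha> + b22 * \<beta>) \<noteq> 0"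
    proof (rule ccontr)
      assume "\<nexists>\<alpha> \<beta>. \<alpha> * (b11 * \<alpha> + b12 * \<beta>) + \<beta> * (b21 * \<alpha> + b22 * \<beta>) \<noteq> 0"
      then have *: "\<alpha> * (b11 * \<alpha> + b12 * \<beta>) + \<beta> * (b21 * \<alpha> + b22 * \<beta>) = 0" for \<alpha> \<beta> by blast
      show False using *[of 1 0] *[of 0 1] *[of 1 1] False by simp
    qed
    then obtain \<alpha> \<beta> where nz: "\<alpha> * (b11 * \<alpha> + b12 * \<beta>) + \<beta> * (b21 * \<alpha> + b22 * \<beta>) \<noteq> 0" by blast
    \<comment> \<open>With \<open>v = \<alpha> p + \<beta> q\<close> not isotropic, \<open>w = \<gamma> p + \<delta> q\<close> spans the left orthogonal of \<open>v\<close>, and is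
      scaled such that \<open>v w = v v\<close>.\<close>
    define s where "s = \<alpha> * (b11 * \<alpha> + b12 * \<beta>) + \<beta> * (b21 * \<alpha> + b22 * \<beta>)"
    define \<gamma> where "\<gamma> = - (b21 * \<alpha> + b22 * \<beta>)"
    define \<delta> where "\<delta> = b11 * \<alpha> + b12 * \<beta>"
    define l where "l = (\<gamma> * (b11 * \<gamma> + b12 * \<delta>) + \<delta> * (b21 * \<gamma> + b22 * \<delta>)) / s"
    \<comment> \<open>With these coefficients the determinant of the base change is
      \<open>s\<close>, and the product of v and w is \<open>(b12 - b21) * s\<close>, which the
      normalization makes equal to the square of v.\<close>
    have b12: "b12 = b21 + 1" using b by (simp add: algebra_simps)
    have "form_basis mul 1 1 0 l (scl \<alpha> p + scl \<beta> q) (scl \<gamma> p + scl \<delta> q) (scl s r)"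
    proof (rule form_basis_change[OF fb])
      show "\<alpha> * \<delta> - \<beta> * \<gamma> \<noteq> 0" "s \<noteq> 0"
        using nz by (simp_all add: s_def \<gamma>_def \<delta>_def algebra_simps)
      show "\<gamma> * (b11 * \<gamma> + b12 * \<delta>) + \<delta> * (b21 * \<gamma> + b22 * \<delta>) = s * l"
        using nz by (simp add: l_def s_def[symmetric])
    qed (simp_all add: s_def \<gamma>_def \<delta>_def b12 algebra_simps)
    then obtain p q r l where fb': "form_basis mul 1 1 0 l p q r" by blast
    show ?thesis
    proof (cases "l = 0")
      case True
      \<comment> \<open>For the Gram matrix \<open>(1 1; 0 0)\<close>, the left kernel is spanned by
        \<open>q\<close> and the right kernel by \<open>p - q\<close>; these two, in this order, are
        the new basis.\<close>
      have "form_basis mul 0 0 1 0 (scl 0 p + scl 1 q) (scl 1 p + scl (- 1) q) (scl 1 r)"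
        using True by (intro form_basis_change[OF fb']) auto
      then show ?thesis by blast
    qed (use fb' in blast)
  qed
qed

end

section \<open>The affine group in dimension three\<close>

abbreviation "e1 \<equiv> (1, 0, 0)"
abbreviation "e2 \<equiv> (0, 1, 0)"
abbreviation "e3 \<equiv> (0, 0, 1)"

definition aff_mat :: "'a::field triple \<Rightarrow> 'a triple \<Rightarrow> 'a triple \<Rightarrow> 'a triple \<Rightarrow> 'a mat" where
  "aff_mat v p q r = mat_of_rows_list 4
     [[1, fst v, fst (snd v), snd (snd v)], [0, fst p, fst (snd p), snd (snd p)],
      [0, fst q, fst (snd q), snd (snd q)], [0, fst r, fst (snd r), snd (snd r)]]"

lemma less_4_iff: "(i::nat) < 4 \<longleftrightarrow> i = 0 \<or> i = 1 \<or> i = 2 \<or> i = 3"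
  by auto

lemma sum_lessThan_4: "(\<Sum>i\<in>{0..<4::nat}. f i) = f 0 + f 1 + f 2 + (f 3 :: 'a::comm_monoid_add)"
  by (simp add: numeral_eq_Suc add.assoc)

lemma mat_of_rows_list_4_carrier [simp]: "mat_of_rows_list 4 [a, b, c, d] \<in> carrier_mat 4 4"
  by (rule carrier_matI) (simp_all add: mat_of_rows_list_def)

lemma mat_of_rows_list_4_dim [simp]:
  "dim_row (mat_of_rows_list 4 [a, b, c, d]) = 4" "dim_col (mat_of_rows_list 4 [a, b, c, d]) = 4"
  by (simp_all add: mat_of_rows_list_def)

lemma mat_of_rows_list_4_index [simp]:
  "i < 4 \<Longrightarrow> j < 4 \<Longrightarrow> mat_of_rows_list 4 [a, b, c, d] $$ (i, j) = [a, b, c, d] ! i ! j"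
  by (simp add: mat_of_rows_list_def)

lemma eq_mat_4I:
  assumes "A \<in> carrier_mat 4 4" "B \<in> carrier_mat 4 4"
    and "\<And>i j. i \<in> {0, 1, 2, 3} \<Longrightarrow> j \<in> {0, 1, 2, 3} \<Longrightarrow> A $$ (i, j) = B $$ (i, j)"
  shows "A = B"
  using assms by (intro eq_matI) (auto simp: less_4_iff)

lemma mult_4_index:
  assumes "A \<in> carrier_mat 4 4" "B \<in> carrier_mat 4 4" "i < 4" "j < 4"
  shows "(A * B) $$ (i, j) =
    A $$ (i, 0) * B $$ (0, j) + A $$ (i, 1) * B $$ (1, j) + A $$ (i, 2) * B $$ (2, j) + A $$ (i, 3) * B $$ (3, j)"
  using assms by (simp add: scalar_prod_def sum_lessThan_4)

lemma aff_mat_carrier [simp]: "aff_mat v p q r \<in> carrier_mat 4 4"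
  by (simp add: aff_mat_def)

lemma aff_mat_mult:
  "aff_mat v p q r * aff_mat v' p' q' r' =
    aff_mat (v' + lc v p' q' r') (lc p p' q' r') (lc q p' q' r') (lc r p' q' r')"
proof (rule eq_mat_4I)
  fix i j :: nat assume ij: "i \<in> {0, 1, 2, 3}" "j \<in> {0, 1, 2, 3}"
  then have "i < 4" "j < 4" by auto
  with ij show "(aff_mat v p q r * aff_mat v' p' q' r') $$ (i, j) =
    aff_mat (v' + lc v p' q' r') (lc p p' q' r') (lc q p' q' r') (lc r p' q' r') $$ (i, j)"
    unfolding mult_4_index[OF aff_mat_carrier aff_mat_carrier \<open>i < 4\<close> \<open>j < 4\<close>]
    by (auto simp: aff_mat_def lc_def scl_def)
qed (simp_all add: mult_carrier_mat[OF aff_mat_carrier aff_mat_carrier])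

lemma aff_mat_inject:
  "aff_mat v p q r = aff_mat v' p' q' r' \<longleftrightarrow> v = v' \<and> p = p' \<and> q = q' \<and> r = r'"
proof
  assume eq: "aff_mat v p q r = aff_mat v' p' q' r'"
  have "aff_mat v p q r $$ (i, j) = aff_mat v' p' q' r' $$ (i, j)" for i j
    using eq by simp
  from this[of 0 1] this[of 0 2] this[of 0 3] this[of 1 1] this[of 1 2] this[of 1 3]
    this[of 2 1] this[of 2 2] this[of 2 3] this[of 3 1] this[of 3 2] this[of 3 3]
  show "v = v' \<and> p = p' \<and> q = q' \<and> r = r'"
    by (simp add: aff_mat_def prod_eq_iff)
qed auto

lemma aff_mat_one: "aff_mat 0 e1 e2 e3 = 1\<^sub>m 4"
  by (rule eq_mat_4I) (auto simp: aff_mat_def zero_prod_def)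

lemma lc_unit [simp]: "lc x e1 e2 e3 = x" "lc e1 p q r = p" "lc e2 p q r = q" "lc e3 p q r = r" "lc 0 p q r = 0"
  by (simp_all add: lc_def scl_def zero_prod_def)

lemma lc_add: "lc (x + y) p q r = lc x p q r + lc y p q r"
  by (simp add: lc_def triple.scale_left_distrib algebra_simps)

lemma col_0_unit_imp_aff_mat:
  assumes "A \<in> carrier_mat 4 4" "col A 0 = unit_vec 4 0"
  shows "A = aff_mat (A $$ (0,1), A $$ (0,2), A $$ (0,3)) (A $$ (1,1), A $$ (1,2), A $$ (1,3))
    (A $$ (2,1), A $$ (2,2), A $$ (2,3)) (A $$ (3,1), A $$ (3,2), A $$ (3,3))"
proof -
  have "A $$ (i, 0) = unit_vec 4 0 $ i" if "i < 4" for i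
    using assms that by (metis carrier_matD index_col zero_less_numeral)
  from this[of 0] this[of 1] this[of 2] this[of 3] show ?thesis
    by (intro eq_mat_4I assms(1) aff_mat_carrier) (auto simp: aff_mat_def)
qed

lemma col_0_aff_mat: "col (aff_mat v p q r) 0 = unit_vec 4 0"
  by (rule eq_vecI) (auto simp: aff_mat_def less_4_iff)

lemma AGL_simps [simp]:
  "monoid.mult (AGL n) = (*)" "one (AGL n) = 1\<^sub>m (n + 1)"
  "carrier (AGL n) = {h \<in> Units (ring_mat TYPE('a::field) (n + 1) ()). col h 0 = unit_vec (n + 1) 0}"
  by (simp_all add: AGL_def GL_def units_of_def ring_mat_simps)

lemma indep_inverse:
  assumes "indep p q r"
  shows "\<exists>v' p' q' r'. aff_mat v' p' q' r' * aff_mat v p q r = 1\<^sub>m 4"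
proof -
  have "\<exists>x. lc x p q r = y" for y
    using indep_span[OF assms, of y] by (metis lc_Pair)
  then obtain v' p' q' r' where "lc v' p q r = - v" "lc p' p q r = e1" "lc q' p q r = e2" "lc r' p q r = e3"
    by metis
  then show ?thesis unfolding aff_mat_mult aff_mat_one[symmetric] aff_mat_inject
    by (intro exI[of _ v'] exI[of _ p'] exI[of _ q'] exI[of _ r']) simp
qed

lemma aff_mat_Units_iff:
  "aff_mat v p q r \<in> Units (ring_mat TYPE('a::field) 4 ()) \<longleftrightarrow> indep p q (r :: 'a triple)"
proof
  assume ind: "indep p q r"
  obtain B where "B \<in> carrier_mat 4 4" "B * aff_mat v p q r = 1\<^sub>m 4"
    using indep_inverse[OF ind] aff_mat_carrier by metis
  then show "aff_mat v p q r \<in> Units (ring_mat TYPE('a) 4 ())"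
    using mat_mult_left_right_inverse[of B 4 "aff_mat v p q r"]
    unfolding Units_def ring_mat_simps by force
next
  assume "aff_mat v p q r \<in> Units (ring_mat TYPE('a) 4 ())"
  then obtain B where B: "B \<in> carrier_mat 4 4" "aff_mat v p q r * B = 1\<^sub>m 4"
    using monoid.Units_r_inv_ex[OF ring.is_monoid[OF ring_mat]] unfolding ring_mat_simps by metis
  \<comment> \<open>If \<open>x\<close> combines the rows to 0, the translation by \<open>x\<close>
    fixes the matrix under left multiplication; cancelling the right inverse makes this translation
    the identity.\<close>
  have 0: "x = 0" if "lc x p q r = 0" for x
  proof -
    have "aff_mat x e1 e2 e3 * (aff_mat v p q r * B) = aff_mat x e1 e2 e3 * aff_mat v p q r * B"
      by (rule assoc_mult_mat[OF aff_mat_carrier aff_mat_carrier B(1), symmetric])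
    also have "aff_mat x e1 e2 e3 * aff_mat v p q r = aff_mat v p q r"
      using that by (simp add: aff_mat_mult)
    finally have "aff_mat x e1 e2 e3 = aff_mat 0 e1 e2 e3"
      unfolding B(2) aff_mat_one using right_mult_one_mat[OF aff_mat_carrier] by metis
    then show "x = 0" by (simp only: aff_mat_inject)
  qed
  have "(a, b, c) = 0" if "scl a p + scl b q + scl c r = 0" for a b c
    by (rule 0) (simp only: lc_Pair that)
  then show "indep p q r"
    by (intro indepI) (simp add: zero_prod_def)
qed

lemma carrier_AGL_3: "carrier (AGL 3) = {aff_mat v p q r | v p q (r :: 'a::field triple). indep p q r}"
proof (intro equalityI subsetI)
  fix h :: "'a mat" assume h: "h \<in> carrier (AGL 3)"
  then have hc: "h \<in> carrier_mat 4 4" "col h 0 = unit_vec 4 0" "h \<in> Units (ring_mat TYPE('a) 4 ())"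
    by (simp_all add: Units_def ring_mat_simps)
  then show "h \<in> {aff_mat v p q r | v p q r. indep p q r}"
    using col_0_unit_imp_aff_mat[OF hc(1,2)] aff_mat_Units_iff by (metis (mono_tags, lifting) mem_Collect_eq)
qed (auto simp: col_0_aff_mat aff_mat_Units_iff)

lemma group_AGL_3: "group (AGL 3 :: 'a::field mat monoid)"
proof (rule groupI)
  let ?R = "ring_mat TYPE('a) 4 ()"
  interpret R: ring ?R by (rule ring_mat)
  have C: "carrier (AGL 3) = {h \<in> Units ?R. col h 0 = unit_vec 4 0}" by simp
  fix x y z :: "'a mat" assume x: "x \<in> carrier (AGL 3)" and y: "y \<in> carrier (AGL 3)"
  from x obtain v p q r where x': "x = aff_mat v p q r" "indep p q r" unfolding carrier_AGL_3 by auto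
  from y obtain v' p' q' r' where y': "y = aff_mat v' p' q' r'" "indep p' q' r'" unfolding carrier_AGL_3 by auto
  have "x \<in> Units ?R" "y \<in> Units ?R"
    using x' y' by (simp_all add: aff_mat_Units_iff)
  from R.Units_m_closed[OF this] have "x * y \<in> Units ?R"
    by (simp only: ring_mat_simps)
  then show "x \<otimes>\<^bsub>AGL 3\<^esub> y \<in> carrier (AGL 3)"
    unfolding C AGL_simps(1) by (simp add: x' y' aff_mat_mult col_0_aff_mat)
  show "\<one>\<^bsub>AGL 3\<^esub> \<otimes>\<^bsub>AGL 3\<^esub> x = x" by (simp add: x' left_mult_one_mat[of _ 4 4])
  {
    assume "z \<in> carrier (AGL 3)"
    then obtain v'' p'' q'' r'' where z': "z = aff_mat v'' p'' q'' r''" unfolding carrier_AGL_3 by auto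
    show "x \<otimes>\<^bsub>AGL 3\<^esub> y \<otimes>\<^bsub>AGL 3\<^esub> z = x \<otimes>\<^bsub>AGL 3\<^esub> (y \<otimes>\<^bsub>AGL 3\<^esub> z)"
      by (simp add: x' y' z' assoc_mult_mat[of _ 4 4 _ 4 _ 4])
  }
  obtain v' p' q' r' where i: "aff_mat v' p' q' r' * x = 1\<^sub>m 4"
    using indep_inverse x' by metis
  have "x * aff_mat v' p' q' r' = 1\<^sub>m 4"
    using mat_mult_left_right_inverse[OF _ _ i] x' by simp
  then have "aff_mat v' p' q' r' \<in> Units ?R"
    using i x' unfolding Units_def ring_mat_simps by force
  then show "\<exists>y\<in>carrier (AGL 3). y \<otimes>\<^bsub>AGL 3\<^esub> x = \<one>\<^bsub>AGL 3\<^esub>"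
    unfolding C using i by (intro bexI[of _ "aff_mat v' p' q' r'"]) (simp_all add: col_0_aff_mat)
next
  show "\<one>\<^bsub>AGL 3\<^esub> \<in> carrier (AGL 3 :: 'a mat monoid)"
  proof -
    have "indep e1 e2 (e3 :: 'a triple)" by (rule indepI) (simp add: zero_prod_def)
    then have "aff_mat 0 e1 e2 (e3 :: 'a triple) \<in> carrier (AGL 3)" unfolding carrier_AGL_3 by blast
    then show ?thesis unfolding aff_mat_one by simp
  qed
qed

text \<open>Writing conjugacy as \<open>m * g = g * u\<close> avoids computing the inverse of
  \<open>g\<close>; only explicit products of affine matrices then have to be compared.\<close>

lemma AGL_conjI:
  assumes g: "(g :: 'a::field mat) \<in> carrier (AGL 3)" and U: "U \<subseteq> carrier (AGL 3)" and M: "M \<subseteq> carrier (AGL 3)"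
    and "\<And>u. u \<in> U \<Longrightarrow> \<exists>m\<in>M. m * g = g * u" "\<And>m. m \<in> M \<Longrightarrow> \<exists>u\<in>U. m * g = g * u"
  shows "AGL_conj 3 U M"
proof -
  interpret G: group "AGL 3 :: 'a mat monoid" by (rule group_AGL_3)
  have *: "m = g \<otimes>\<^bsub>AGL 3\<^esub> u \<otimes>\<^bsub>AGL 3\<^esub> inv\<^bsub>AGL 3\<^esub> g" if "m \<in> M" "u \<in> U" "m * g = g * u" for m u
  proof (rule G.inv_solve_right[THEN iffD2])
    show "g \<otimes>\<^bsub>AGL 3\<^esub> u = m \<otimes>\<^bsub>AGL 3\<^esub> g" using that(3) by simp
  qed (use that g U M G.m_closed in blast)+
  have "M = (\<lambda>u. g \<otimes>\<^bsub>AGL 3\<^esub> u \<otimes>\<^bsub>AGL 3\<^esub> inv\<^bsub>AGL 3\<^esub> g) ` U"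
  proof (intro equalityI subsetI)
    fix m assume "m \<in> M"
    then show "m \<in> (\<lambda>u. g \<otimes>\<^bsub>AGL 3\<^esub> u \<otimes>\<^bsub>AGL 3\<^esub> inv\<^bsub>AGL 3\<^esub> g) ` U"
    proof -
      obtain u where u: "u \<in> U" "m * g = g * u" using assms(5)[OF \<open>m \<in> M\<close>] ..
      show ?thesis by (rule image_eqI) (rule *[OF \<open>m \<in> M\<close> u], rule u(1))
    qed
  next
    fix m assume "m \<in> (\<lambda>u. g \<otimes>\<^bsub>AGL 3\<^esub> u \<otimes>\<^bsub>AGL 3\<^esub> inv\<^bsub>AGL 3\<^esub> g) ` U"
    then obtain u where u: "u \<in> U" "m = g \<otimes>\<^bsub>AGL 3\<^esub> u \<otimes>\<^bsub>AGL 3\<^esub> inv\<^bsub>AGL 3\<^esub> g" by (rule imageE)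
    obtain m' where "m' \<in> M" "m' * g = g * u" using assms(4)[OF u(1)] ..
    then show "m \<in> M" using *[OF _ u(1)] u(2) by simp
  qed
  then show ?thesis unfolding AGL_conj_def using g by blast
qed

lemma AGL_conjE:
  assumes "AGL_conj 3 U M" and U: "U \<subseteq> carrier (AGL 3)"
  obtains g where "(g :: 'a::field mat) \<in> carrier (AGL 3)"
    "\<And>u. u \<in> U \<Longrightarrow> \<exists>m\<in>M. m * g = g * u" "\<And>m. m \<in> M \<Longrightarrow> \<exists>u\<in>U. m * g = g * u"
proof -
  interpret G: group "AGL 3 :: 'a mat monoid" by (rule group_AGL_3)
  obtain g where g: "g \<in> carrier (AGL 3)" "M = (\<lambda>u. g \<otimes>\<^bsub>AGL 3\<^esub> u \<otimes>\<^bsub>AGL 3\<^esub> inv\<^bsub>AGL 3\<^esub> g) ` U"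
    using assms(1) unfolding AGL_conj_def by blast
  have "(g \<otimes>\<^bsub>AGL 3\<^esub> u \<otimes>\<^bsub>AGL 3\<^esub> inv\<^bsub>AGL 3\<^esub> g) \<otimes>\<^bsub>AGL 3\<^esub> g = g \<otimes>\<^bsub>AGL 3\<^esub> u" if "u \<in> U" for u
  proof -
    have "u \<in> carrier (AGL 3)" using that U by blast
    then show ?thesis using g(1) by (metis G.inv_closed G.l_inv G.m_assoc G.m_closed G.r_one)
  qed
  then have *: "(g \<otimes>\<^bsub>AGL 3\<^esub> u \<otimes>\<^bsub>AGL 3\<^esub> inv\<^bsub>AGL 3\<^esub> g) * g = g * u" if "u \<in> U" for u
    using that by simp
  show thesis
  proof (rule that[OF g(1)])
    show "\<exists>m\<in>M. m * g = g * u" if "u \<in> U" for u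
      unfolding g(2) by (rule bexI[where x = "g \<otimes>\<^bsub>AGL 3\<^esub> u \<otimes>\<^bsub>AGL 3\<^esub> inv\<^bsub>AGL 3\<^esub> g"])
        (rule *[OF that], rule imageI, rule that)
    show "\<exists>u\<in>U. m * g = g * u" if "m \<in> M" for m
      using that * unfolding g(2) by (metis (no_types, lifting) imageE)
  qed
qed

section \<open>Regular subgroups as algebras\<close>

text \<open>A regular subgroup with linear \<open>\<delta>\<close> turns the row vectors into an algebra with the product
  \<open>x \<cdot> v = x \<delta>(v)\<close>, which recovers the element of the subgroup with first row \<open>(1, v)\<close>.\<close>

definition alg_mat :: "('a::field triple \<Rightarrow> 'a triple \<Rightarrow> 'a triple) \<Rightarrow> 'a triple \<Rightarrow> 'a mat" where
  "alg_mat mul v = aff_mat v (e1 + mul e1 v) (e2 + mul e2 v) (e3 + mul e3 v)"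

lemma alg_mat_inject [simp]: "alg_mat mul v = alg_mat mul w \<longleftrightarrow> v = w"
  unfolding alg_mat_def aff_mat_inject by auto

context triple_algebra
begin

lemma lc_mul: "lc x (mul e1 v) (mul e2 v) (mul e3 v) = mul x v"
proof -
  have "mul x v = mul (lc x e1 e2 e3) v" by simp
  also have "\<dots> = lc x (mul e1 v) (mul e2 v) (mul e3 v)" by (simp only: lc_def bilin)
  finally show ?thesis by simp
qed

lemma lc_alg_mat: "lc x (e1 + mul e1 v) (e2 + mul e2 v) (e3 + mul e3 v) = x + mul x v"
proof -
  have "lc x (e1 + mul e1 v) (e2 + mul e2 v) (e3 + mul e3 v) =
      lc x e1 e2 e3 + lc x (mul e1 v) (mul e2 v) (mul e3 v)"
    by (simp only: lc_def triple.scale_right_distrib ac_simps)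
  then show ?thesis by (simp only: lc_unit lc_mul)
qed

lemma aff_mat_mult_alg_mat:
  "aff_mat u p q r * alg_mat mul v = aff_mat (v + (u + mul u v)) (p + mul p v) (q + mul q v) (r + mul r v)"
  unfolding alg_mat_def aff_mat_mult lc_alg_mat ..

text \<open>The group law is the circle operation of the algebra: formally, (1 + v)(1 + w) = 1 + v +
  w + vw.\<close>

lemma alg_mat_mult: "alg_mat mul v * alg_mat mul w = alg_mat mul (v + w + mul v w)"
  unfolding alg_mat_def[of _ v] aff_mat_mult_alg_mat
  unfolding alg_mat_def by (simp add: bilin assoc ac_simps)

lemma alg_mat_mult_aff_mat:
  "alg_mat mul v * aff_mat u p q r = aff_mat (u + lc v p q r)
    (p + lc (mul e1 v) p q r) (q + lc (mul e2 v) p q r) (r + lc (mul e3 v) p q r)"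
  unfolding alg_mat_def aff_mat_mult lc_add lc_unit ..

end

lemma (in quasiregular_algebra) alg_mat_AGL: "alg_mat mul v \<in> carrier (AGL 3)"
proof -
  have "indep (e1 + mul e1 v) (e2 + mul e2 v) (e3 + mul e3 v)"
  proof (rule indepI)
    fix a b c
    assume "scl a (e1 + mul e1 v) + scl b (e2 + mul e2 v) + scl c (e3 + mul e3 v) = 0"
    then have "(a, b, c) + mul (a, b, c) v = 0" by (simp only: lc_Pair[symmetric] lc_alg_mat)
    then have "(a, b, c) = 0" by (rule quasiregular)
    then show "a = 0 \<and> b = 0 \<and> c = 0" by (simp add: zero_prod_def)
  qed
  then show ?thesis unfolding carrier_AGL_3 alg_mat_def by blast
qed

definition vec3 :: "'a triple \<Rightarrow> 'a vec" where
  "vec3 v = vec_of_list [fst v, fst (snd v), snd (snd v)]"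

lemma vec3_carrier [simp]: "vec3 v \<in> carrier_vec 3"
  by (rule carrier_vecI) (simp add: vec3_def)

lemma vec3_index [simp]: "vec3 v $ 0 = fst v" "vec3 v $ Suc 0 = fst (snd v)" "vec3 v $ 2 = snd (snd v)"
  by (simp_all add: vec3_def numeral_2_eq_2)

lemma less_3_iff: "(i::nat) < 3 \<longleftrightarrow> i = 0 \<or> i = 1 \<or> i = 2"
  by auto

lemma dim_vec3 [simp]: "dim_vec (vec3 v) = 3"
  by (simp add: vec3_def)

lemma vec3_surj:
  assumes "w \<in> carrier_vec 3"
  shows "w = vec3 (w $ 0, w $ 1, w $ 2)"
  using assms by (intro eq_vecI) (auto simp: less_3_iff)

lemma vec3_inject [simp]: "vec3 v = vec3 w \<longleftrightarrow> v = w"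
  by (metis prod.collapse vec3_index)

lemma vec3_add: "vec3 (v + w) = vec3 v + vec3 w"
  by (rule eq_vecI) (auto simp: less_3_iff)

lemma vec3_scl: "vec3 (scl c v) = c \<cdot>\<^sub>v vec3 v"
  by (rule eq_vecI) (auto simp: less_3_iff scl_def)

lemma row_aff_mat: "row (aff_mat v p q r) 0 = vCons 1 (vec3 v)"
  by (rule eq_vecI) (auto simp: aff_mat_def less_4_iff vec3_def numeral_2_eq_2 numeral_3_eq_3 less_Suc_eq)

lemma lin_part_aff_mat:
  "lin_part (aff_mat v p q r) = mat_of_rows_list 3 [[fst p, fst (snd p), snd (snd p)],
     [fst q, fst (snd q), snd (snd q)], [fst r, fst (snd r), snd (snd r)]]"
  unfolding lin_part_def mat_delete_def
  by (rule eq_matI) (auto simp: aff_mat_def mat_of_rows_list_def less_3_iff numeral_2_eq_2 less_Suc_eq)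

definition row_triple :: "'a mat \<Rightarrow> nat \<Rightarrow> 'a triple" where
  "row_triple A i = (A $$ (i, 0), A $$ (i, 1), A $$ (i, 2))"

lemma row_triple_add:
  "A \<in> carrier_mat 3 3 \<Longrightarrow> B \<in> carrier_mat 3 3 \<Longrightarrow> i < 3 \<Longrightarrow>
    row_triple (A + B) i = row_triple A i + row_triple B i"
  by (simp add: row_triple_def)

lemma row_triple_smult:
  "A \<in> carrier_mat 3 3 \<Longrightarrow> i < 3 \<Longrightarrow> row_triple (c \<cdot>\<^sub>m A) i = scl c (row_triple A i)"
  by (simp add: row_triple_def)

lemma scl_lc: "lc (scl c x) p q r = scl c (lc x p q r)"
  by (simp add: lc_def scl_def algebra_simps)

lemma lc_add_right: "lc x (p + p') (q + q') (r + r') = lc x p q r + lc x p' q' r'"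
  by (simp add: lc_def triple.scale_right_distrib algebra_simps)

lemma lc_scl_right: "lc x (scl c p) (scl c q) (scl c r) = scl c (lc x p q r)"
  by (simp add: lc_def scl_def algebra_simps)

definition delta_mul :: "'a::field mat set \<Rightarrow> 'a triple \<Rightarrow> 'a triple \<Rightarrow> 'a triple" where
  "delta_mul U x v = (let D = delta 3 U (vec3 v) in lc x (row_triple D 0) (row_triple D 1) (row_triple D 2))"

text \<open>Linearity of \<open>delta\<close> gives bilinearity, invertibility of the linear parts
  gives quasiregularity, and closure of \<open>U\<close> under multiplication gives
  associativity.\<close>

lemma regular_linear_algebra:
  assumes reg: "regular 3 U" and lin: "delta_linear 3 (U :: 'a::field mat set)"
  shows "quasiregular_algebra (delta_mul U)" and "U = range (alg_mat (delta_mul U))"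
proof -
  have sub: "subgroup U (AGL 3)" using reg by (simp add: regular_def)
  have U_aff: "\<exists>v p q r. u = aff_mat v p q r \<and> indep p q r" if "u \<in> U" for u
    using subgroup.subset[OF sub] that unfolding carrier_AGL_3 by blast
  have mult: "u * u' \<in> U" if "u \<in> U" "u' \<in> U" for u u'
    using subgroup.m_closed[OF sub that] by simp
  have ex1: "\<exists>!h. h \<in> U \<and> row h 0 = vCons 1 (vec3 v)" for v
    using reg by (simp add: regular_def)
  interpret D: linear_map class_ring "module_vec TYPE('a) 3" "module_mat TYPE('a) 3 3" "delta 3 U"
    using lin by (simp add: delta_linear_def)
  have Dc: "delta 3 U (vec3 v) \<in> carrier_mat 3 3" for v
    using D.T_im[of "vec3 v"] by (simp add: module_vec_simps module_mat_simps)
  have Dadd: "delta 3 U (vec3 (v + w)) = delta 3 U (vec3 v) + delta 3 U (vec3 w)" for v w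
    using D.T_add[of "vec3 v" "vec3 w"] by (simp add: module_vec_simps module_mat_simps vec3_add)
  have Dscl: "delta 3 U (vec3 (scl c v)) = c \<cdot>\<^sub>m delta 3 U (vec3 v)" for c v
    using D.T_smult[of c "vec3 v"] by (simp add: module_vec_simps module_mat_simps vec3_scl class_ring_simps)
  have mul_e: "delta_mul U e1 v = row_triple (delta 3 U (vec3 v)) 0"
    "delta_mul U e2 v = row_triple (delta 3 U (vec3 v)) 1"
    "delta_mul U e3 v = row_triple (delta 3 U (vec3 v)) 2" for v
    by (simp_all add: delta_mul_def Let_def)
  \<comment> \<open>By regularity there is only one element with this first row, so the definite
    description in \<open>delta\<close> returns this very matrix.\<close>
  have aff: "aff_mat v p q r = alg_mat (delta_mul U) v" if "aff_mat v p q r \<in> U" for v p q r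
  proof -
    have "(THE h. h \<in> U \<and> row h 0 = vCons 1 (vec3 v)) = aff_mat v p q r"
      by (rule the1_equality[OF ex1]) (simp add: that row_aff_mat)
    then have "delta 3 U (vec3 v) = lin_part (aff_mat v p q r) - 1\<^sub>m 3"
      by (simp add: delta_def)
    then show ?thesis
      unfolding alg_mat_def aff_mat_inject mul_e lin_part_aff_mat
      by (simp add: row_triple_def mat_of_rows_list_def prod_eq_iff)
  qed
  have in_U: "alg_mat (delta_mul U) v \<in> U" for v
  proof -
    obtain h where h: "h \<in> U" "row h 0 = vCons 1 (vec3 v)" using ex1[of v] by blast
    obtain v' p q r where h': "h = aff_mat v' p q r" using U_aff[OF h(1)] by blast
    with h(2) have "v' = v" by (simp add: row_aff_mat)
    then show ?thesis using aff h h' by metis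
  qed
  show U: "U = range (alg_mat (delta_mul U))"
  proof (intro equalityI subsetI)
    fix u assume "u \<in> U"
    with aff U_aff[OF this] show "u \<in> range (alg_mat (delta_mul U))" by (metis rangeI)
  qed (use in_U in blast)
  have bil: "delta_mul U (x + y) v = delta_mul U x v + delta_mul U y v"
    "delta_mul U x (v + w) = delta_mul U x v + delta_mul U x w"
    "delta_mul U (scl c x) v = scl c (delta_mul U x v)"
    "delta_mul U x (scl c v) = scl c (delta_mul U x v)" for x y v w c
    by (simp_all add: delta_mul_def Let_def lc_add scl_lc Dadd Dscl row_triple_add row_triple_smult Dc
        lc_add_right lc_scl_right)
  have lc_mul: "lc x (delta_mul U e1 v) (delta_mul U e2 v) (delta_mul U e3 v) = delta_mul U x v" for x v
    by (simp add: mul_e delta_mul_def Let_def)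
  have lc_alg: "lc x (e1 + delta_mul U e1 v) (e2 + delta_mul U e2 v) (e3 + delta_mul U e3 v) =
      x + delta_mul U x v" for x v
    by (simp only: lc_add_right lc_unit lc_mul)
  \<comment> \<open>The product of the elements for \<open>v\<close> and \<open>w\<close> lies in
    \<open>U\<close> and so is determined by its first row. Comparing its other rows with those
    prescribed by \<open>delta_mul\<close> is associativity with a unit vector on the left.\<close>
  have assoc_unit: "delta_mul U (delta_mul U e v) w = delta_mul U e (delta_mul U v w)"
    if "e \<in> {e1, e2, e3}" for e v w
  proof -
    have "alg_mat (delta_mul U) v * alg_mat (delta_mul U) w =
      aff_mat (w + (v + delta_mul U v w)) (e1 + delta_mul U e1 v + delta_mul U (e1 + delta_mul U e1 v) w)
       (e2 + delta_mul U e2 v + delta_mul U (e2 + delta_mul U e2 v) w)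
       (e3 + delta_mul U e3 v + delta_mul U (e3 + delta_mul U e3 v) w)" (is "_ = ?A")
      unfolding alg_mat_def aff_mat_mult lc_alg ..
    then have "?A \<in> U" using mult[OF in_U in_U] by metis
    from aff[OF this] have
      "e + delta_mul U e v + delta_mul U (e + delta_mul U e v) w = e + delta_mul U e (w + (v + delta_mul U v w))"
      using that unfolding alg_mat_def aff_mat_inject by blast
    then show ?thesis by (simp add: bil algebra_simps)
  qed
  have assoc: "delta_mul U (delta_mul U x v) w = delta_mul U x (delta_mul U v w)" for x v w
  proof -
    have "x = scl (fst x) e1 + scl (fst (snd x)) e2 + scl (snd (snd x)) e3"
      by (simp add: prod_eq_iff)
    then obtain a b c where x: "x = scl a e1 + scl b e2 + scl c e3" by blast
    show ?thesis unfolding x by (simp only: bil assoc_unit insertI1 insertI2)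
  qed
  have quasiregular: "x = 0" if "x + delta_mul U x v = 0" for x v
  proof -
    have "alg_mat (delta_mul U) v \<in> carrier (AGL 3)"
      using in_U subgroup.subset[OF sub] by blast
    then have "indep (e1 + delta_mul U e1 v) (e2 + delta_mul U e2 v) (e3 + delta_mul U e3 v)"
      unfolding carrier_AGL_3 alg_mat_def by (auto simp: aff_mat_inject simp del: split_paired_All split_paired_Ex)
    moreover have "scl (fst x) (e1 + delta_mul U e1 v) + scl (fst (snd x)) (e2 + delta_mul U e2 v) +
        scl (snd (snd x)) (e3 + delta_mul U e3 v) = 0"
      using lc_alg[of x v] that by (simp only: lc_def)
    ultimately show "x = 0" using indepD by (simp add: prod_eq_iff)
  qed
  show "quasiregular_algebra (delta_mul U)"
    by unfold_locales (rule bil assoc | erule quasiregular)+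
qed

section \<open>Model algebras and groups, and conjugacy as equivalence of forms\<close>

definition form_mul :: "'a::field \<Rightarrow> 'a \<Rightarrow> 'a \<Rightarrow> 'a \<Rightarrow> 'a triple \<Rightarrow> 'a triple \<Rightarrow> 'a triple" where
  "form_mul b11 b12 b21 b22 x y = (0, 0,
     fst x * (b11 * fst y + b12 * fst (snd y)) + fst (snd x) * (b21 * fst y + b22 * fst (snd y)))"

interpretation form: quasiregular_algebra "form_mul b11 b12 b21 b22"
  by unfold_locales (auto simp: form_mul_def scl_def prod_eq_iff algebra_simps)

text \<open>All representatives lie in this family with four parameters, so conjugacy and
  presentations are treated once for arbitrary coefficients.\<close>

definition form_group :: "'a::field \<Rightarrow> 'a \<Rightarrow> 'a \<Rightarrow> 'a \<Rightarrow> 'a mat set" where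
  "form_group b11 b12 b21 b22 = range (alg_mat (form_mul b11 b12 b21 b22))"

lemma alg_mat_form_mul: "alg_mat (form_mul b11 b12 b21 b22) (x1, x2, x3) = mat_of_rows_list 4
  [[1, x1, x2, x3], [0, 1, 0, b11 * x1 + b12 * x2], [0, 0, 1, b21 * x1 + b22 * x2], [0, 0, 0, 1]]"
  by (simp add: alg_mat_def aff_mat_def form_mul_def)

lemma form_group_eq: "form_group b11 b12 b21 b22 = {mat_of_rows_list 4
    [[1, x1, x2, x3], [0, 1, 0, b11 * x1 + b12 * x2], [0, 0, 1, b21 * x1 + b22 * x2], [0, 0, 0, 1]] | x1 x2 x3. True}"
  unfolding form_group_def alg_mat_form_mul[symmetric] by auto

lemma N_eq_form_group: "N1 = form_group 0 0 1 0" "N2 = form_group 0 (- 1) 1 0" "N3 l = form_group 1 1 0 l"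
  by (simp_all add: form_group_eq N1_def N2_def N3_def)

context quasiregular_algebra
begin

text \<open>The linear map taking \<open>e1\<close>, \<open>e2\<close>, \<open>e3\<close> to
  \<open>p\<close>, \<open>q\<close>, \<open>r\<close> is an isomorphism from the model algebra onto
  \<open>mul\<close>. Its matrix, with zero translation part, conjugates one group into the
  other.\<close>

lemma form_basis_imp_conj:
  assumes fb: "form_basis mul b11 b12 b21 b22 p q r"
  shows "AGL_conj 3 (range (alg_mat mul)) (form_group b11 b12 b21 b22)"
proof -
  let ?f = "form_mul b11 b12 b21 b22"
  have ind: "indep p q r" using fb by (simp add: form_basis_def)
  have eq: "alg_mat ?f y * aff_mat 0 p q r = aff_mat 0 p q r * alg_mat mul (lc y p q r)" for y
  proof -
    obtain a b c where y: "y = (a, b, c)" by (cases y)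
    show ?thesis
      unfolding form.alg_mat_mult_aff_mat aff_mat_mult_alg_mat aff_mat_inject
      using form_basis_mul[OF fb, of 1 0 0 a b c] form_basis_mul[OF fb, of 0 1 0 a b c]
        form_basis_mul[OF fb, of 0 0 1 a b c]
      by (simp add: form_mul_def y lc_def)
  qed
  have surj: "\<exists>y. v = lc y p q r" for v
    using indep_span[OF ind, of v] by (metis lc_Pair)
  show ?thesis
  proof (rule AGL_conjI)
    show "aff_mat 0 p q r \<in> carrier (AGL 3)" using ind unfolding carrier_AGL_3 by blast
    show "range (alg_mat mul) \<subseteq> carrier (AGL 3)" using alg_mat_AGL by blast
    show "form_group b11 b12 b21 b22 \<subseteq> carrier (AGL 3)"
      using form.alg_mat_AGL unfolding form_group_def by blast
    show "\<exists>m\<in>form_group b11 b12 b21 b22. m * aff_mat 0 p q r = aff_mat 0 p q r * u"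
      if u: "u \<in> range (alg_mat mul)" for u
    proof -
      obtain v where "u = alg_mat mul v" using u by (rule rangeE)
      moreover obtain y where "v = lc y p q r" using surj[of v] ..
      ultimately show ?thesis
        unfolding form_group_def by (intro bexI[of _ "alg_mat ?f y"] rangeI) (simp only: eq)
    qed
    show "\<exists>u\<in>range (alg_mat mul). m * aff_mat 0 p q r = aff_mat 0 p q r * u"
      if m: "m \<in> form_group b11 b12 b21 b22" for m
    proof -
      obtain y where "m = alg_mat ?f y" using m unfolding form_group_def by (rule rangeE)
      then show ?thesis
        by (intro bexI[of _ "alg_mat mul (lc y p q r)"] rangeI) (simp only: eq)
    qed
  qed
qed

text \<open>The first row \<open>(1, u)\<close> of the conjugating matrix enters through left multiplication by \<open>1 + u\<close>, which
  fixes all products because products of three elements vanish.\<close>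

lemma conj_imp_form_basis:
  assumes nil: "\<And>x y z. mul (mul x y) z = 0"
    and conj: "AGL_conj 3 (range (alg_mat mul)) (form_group b11 b12 b21 b22)"
  shows "\<exists>p q r. form_basis mul b11 b12 b21 b22 p q r"
proof -
  let ?f = "form_mul b11 b12 b21 b22"
  have "range (alg_mat mul) \<subseteq> carrier (AGL 3)" using alg_mat_AGL by blast
  then obtain g where g: "g \<in> carrier (AGL 3)"
    and g1: "\<And>u. u \<in> range (alg_mat mul) \<Longrightarrow> \<exists>m\<in>form_group b11 b12 b21 b22. m * g = g * u"
    and g2: "\<And>m. m \<in> form_group b11 b12 b21 b22 \<Longrightarrow> \<exists>u\<in>range (alg_mat mul). m * g = g * u"
    by (rule AGL_conjE[OF conj]) blast
  have conj_y: "\<exists>y. alg_mat ?f y * g = g * alg_mat mul v" for v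
    using g1[OF rangeI, of v] unfolding form_group_def by (simp add: bex_simps del: split_paired_Ex)
  have conj_v: "\<exists>v. alg_mat ?f y * g = g * alg_mat mul v" for y
    using g2[of "alg_mat ?f y"] unfolding form_group_def by (simp del: split_paired_Ex)
  from g obtain u p q r where g': "g = aff_mat u p q r" and ind: "indep p q r"
    unfolding carrier_AGL_3 by blast
  have eq: "alg_mat ?f (a, b, c) * g = g * alg_mat mul v \<longleftrightarrow>
    scl a p + scl b q + scl c r = v + mul u v \<and> mul p v = scl (b11 * a + b12 * b) r \<and>
    mul q v = scl (b21 * a + b22 * b) r \<and> mul r v = 0" for a b c v
    unfolding g' form.alg_mat_mult_aff_mat aff_mat_mult_alg_mat aff_mat_inject
    by (simp add: form_mul_def lc_def ac_simps eq_commute[of "scl _ r"] eq_commute[of "0 :: 'a triple"])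
  \<comment> \<open>The vectors \<open>v1\<close>, \<open>v2\<close>, \<open>v3\<close> correspond
    to \<open>e1\<close>, \<open>e2\<close>, \<open>e3\<close> of the model. They form the sought
    basis; the rows \<open>p\<close>, \<open>q\<close>, \<open>r\<close> of \<open>g\<close> are
    their images under left multiplication by 1 + u.\<close>
  obtain v1 where v1: "p = v1 + mul u v1" "mul p v1 = scl b11 r" "mul q v1 = scl b21 r"
    using conj_v[of e1] unfolding eq by (auto simp del: split_paired_Ex)
  obtain v2 where v2: "q = v2 + mul u v2" "mul p v2 = scl b12 r" "mul q v2 = scl b22 r"
    using conj_v[of e2] unfolding eq by (auto simp del: split_paired_Ex)
  obtain v3 where v3: "r = v3 + mul u v3" "mul p v3 = 0" "mul q v3 = 0" "mul r v3 = 0"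
    using conj_v[of e3] unfolding eq by (auto simp del: split_paired_Ex)
  \<comment> \<open>The rows \<open>p\<close>, \<open>q\<close>, \<open>r\<close> span, so
    \<open>v3\<close> is annihilated from the left by everything, in particular by \<open>u\<close>;
    hence \<open>r\<close> and \<open>v3\<close> coincide.\<close>
  have v3_ann: "mul x v3 = 0" for x
  proof -
    obtain a b c where "x = scl a p + scl b q + scl c r" using indep_span[OF ind] .
    then show ?thesis by (simp add: bilin v3(2-4))
  qed
  then have r: "r = v3" using v3 by simp
  have r_ann: "mul r v = 0" for v
  proof -
    obtain a b c where "alg_mat ?f (a, b, c) * g = g * alg_mat mul v" using conj_y[of v] by (metis prod.collapse)
    then show ?thesis unfolding eq by simp
  qed
  have f: "mul v1 w = mul p w" "mul v2 w = mul q w" for w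
    by (subst v1(1) v2(1), simp add: bilin nil)+
  have "mul v1 v1 = scl b11 r" "mul v1 v2 = scl b12 r" "mul v2 v1 = scl b21 r" "mul v2 v2 = scl b22 r"
    by (simp_all only: f v1(2,3) v2(2,3))
  moreover have "indep v1 v2 r"
  proof (rule indepI)
    fix a b c assume 0: "scl a v1 + scl b v2 + scl c r = 0"
    have "scl a p + scl b q + scl c r = scl a v1 + scl b v2 + scl c r + mul u (scl a v1 + scl b v2 + scl c r)"
      unfolding bilin r v3_ann by (subst v1(1), subst v2(1)) (simp add: triple.scale_right_distrib ac_simps)
    then have "scl a p + scl b q + scl c r = 0" by (simp add: 0)
    then show "a = 0 \<and> b = 0 \<and> c = 0" by (rule indepD[OF ind])
  qed
  ultimately have "form_basis mul b11 b12 b21 b22 v1 v2 r"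
    unfolding form_basis_def using r_ann v3_ann r by simp
  then show ?thesis by blast
qed

lemma alg_mat_commute: "alg_mat mul v * alg_mat mul w = alg_mat mul w * alg_mat mul v \<longleftrightarrow> mul v w = mul w v"
  unfolding alg_mat_mult alg_mat_inject by (simp add: add.commute[of w v])

end

lemma abelian_iff:
  assumes "subgroup U (AGL 3)"
  shows "abelian 3 U \<longleftrightarrow> (\<forall>u\<in>U. \<forall>u'\<in>U. u * u' = u' * (u :: 'a::field mat))"
proof
  assume "abelian 3 U"
  then interpret comm_group "AGL 3\<lparr>carrier := U\<rparr>" by (simp add: abelian_def)
  show "\<forall>u\<in>U. \<forall>u'\<in>U. u * u' = u' * u" using m_comm by simp
next
  assume "\<forall>u\<in>U. \<forall>u'\<in>U. u * u' = u' * u"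
  moreover have "group (AGL 3\<lparr>carrier := U\<rparr>)"
    using subgroup.subgroup_is_group[OF assms group_AGL_3] .
  ultimately show "abelian 3 U" unfolding abelian_def by (intro group.group_comm_groupI) auto
qed

section \<open>Minors, rank and the commutative case\<close>

lemma det_2_by_2:
  assumes A: "A \<in> carrier_mat 2 2"
  shows "det A = A $$ (0, 0) * A $$ (1, 1) - A $$ (0, 1) * (A $$ (1, 0) :: 'a::comm_ring_1)"
proof -
  have "det (mat_delete A 0 j) = mat_delete A 0 j $$ (0, 0)" for j
    using A by (intro det_single) (auto simp: mat_delete_def)
  then show ?thesis
    unfolding laplace_expansion_row[OF A, of 0, simplified]
    using A by (simp add: cofactor_def numeral_2_eq_2 lessThan_Suc) (simp add: mat_delete_def)
qed

lemma (in vec_space) rank_ge_2: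
  assumes A: "A \<in> carrier_mat n nc" and i: "i < i'" "i' < n" and j: "j < j'" "j' < nc"
    and minor: "A $$ (i, j) * A $$ (i', j') \<noteq> A $$ (i, j') * A $$ (i', j)"
  shows "2 \<le> rank A"
proof -
  have pick: "pick {a, b} 0 = a" "pick {a, b} (Suc 0) = b" if "a < b" for a b :: nat
  proof -
    show *: "pick {a, b} 0 = a" using that by (auto intro!: Least_equality)
    show "pick {a, b} (Suc 0) = b" using that by (auto simp: * simp del: pick.simps(1) intro!: Least_equality)
  qed
  let ?S = "submatrix A {i, i'} {j, j'}"
  have sets: "{k. k < n \<and> k \<in> {i, i'}} = {i, i'}" "{k. k < nc \<and> k \<in> {j, j'}} = {j, j'}"
    using i j by auto
  then have S: "?S \<in> carrier_mat 2 2"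
    and S': "?S = mat 2 2 (\<lambda>(a, b). A $$ (pick {i, i'} a, pick {j, j'} b))"
    using A i j by (simp_all add: submatrix_def numeral_2_eq_2)
  have "det ?S = ?S $$ (0, 0) * ?S $$ (1, 1) - ?S $$ (0, 1) * ?S $$ (1, 0)"
    by (rule det_2_by_2[OF S])
  also have "\<dots> = A $$ (i, j) * A $$ (i', j') - A $$ (i, j') * A $$ (i', j)"
    using pick[OF i(1)] pick[OF j(1)] by (simp add: S' del: pick.simps)
  finally have "det ?S = A $$ (i, j) * A $$ (i', j') - A $$ (i, j') * A $$ (i', j)" .
  then have "det ?S \<noteq> 0" using minor by simp
  from rank_gt_minor[OF A this] show ?thesis unfolding sets using j by simp
qed

text \<open>The group may be infinite, but ranks are bounded by the size of the matrices, so
  \<open>Max\<close> is taken over a finite set.\<close>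

lemma max_rank_ge:
  assumes "u \<in> H" "H \<subseteq> carrier_mat (n + 1) (n + 1)"
  shows "vec_space.rank (n + 1) (u - 1\<^sub>m (n + 1)) \<le> max_rank n (H :: 'a::field mat set)"
proof -
  have "(\<lambda>h. vec_space.rank (n + 1) (h - 1\<^sub>m (n + 1))) ` H \<subseteq> {..n + 1}"
    by (auto intro!: vec_space.rank_le_nc minus_carrier_mat)
  then have "finite ((\<lambda>h. vec_space.rank (n + 1) (h - 1\<^sub>m (n + 1))) ` H)"
    by (rule finite_subset) simp
  then show ?thesis unfolding max_rank_def using assms(1) by (intro Max_ge) auto
qed

lemma proportional:
  fixes v w :: "'a::field triple"
  assumes "fst v * fst (snd w) = fst (snd v) * fst w" "fst v * snd (snd w) = snd (snd v) * fst w"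
    "fst (snd v) * snd (snd w) = snd (snd v) * fst (snd w)" "v \<noteq> 0"
  shows "\<exists>c. scl c v = w"
proof -
  obtain v1 v2 v3 w1 w2 w3 where e: "v = (v1, v2, v3)" "w = (w1, w2, w3)" by (metis prod.collapse)
  have "v1 \<noteq> 0 \<or> v2 \<noteq> 0 \<or> v3 \<noteq> 0" using assms(4) by (auto simp: e zero_prod_def)
  then show ?thesis
  proof (elim disjE)
    assume "v1 \<noteq> 0" then show ?thesis using assms by (intro exI[of _ "w1 / v1"]) (simp add: e field_simps)
  next
    assume "v2 \<noteq> 0" then show ?thesis using assms by (intro exI[of _ "w2 / v2"]) (simp add: e field_simps)
  next
    assume "v3 \<noteq> 0" then show ?thesis using assms by (intro exI[of _ "w3 / v3"]) (simp add: e field_simps)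
  qed
qed

lemma translation_subgroup_3: "translation_subgroup 3 = range (\<lambda>v. aff_mat v e1 e2 (e3 :: 'a::field triple))"
proof -
  have *: "four_block_mat (1\<^sub>m 1) (mat_of_row (vec3 v)) (0\<^sub>m 3 1) (1\<^sub>m 3) = aff_mat v e1 e2 e3" for v :: "'a triple"
    by (rule eq_mat_4I) (auto simp: aff_mat_def mat_of_row_def)
  have "translation_subgroup 3 = {four_block_mat (1\<^sub>m 1) (mat_of_row (vec3 v)) (0\<^sub>m 3 1) (1\<^sub>m 3) | v :: 'a triple. True}"
    unfolding translation_subgroup_def using vec3_surj vec3_carrier by (metis (no_types, lifting))
  then show ?thesis unfolding * by (simp add: full_SetCompr_eq del: split_paired_Ex)
qed

lemma (in quasiregular_algebra) commutative_max_rank_1: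
  assumes comm: "\<And>v w. mul v w = mul w v" and rank: "max_rank 3 (range (alg_mat mul)) = 1"
  shows "range (alg_mat mul) = translation_subgroup 3"
proof -
  \<comment> \<open>After subtracting the identity, row 0 is \<open>(0, v)\<close> and row
    \<open>i\<close> is \<open>(0, e v)\<close> for the unit vector \<open>e\<close> number
    \<open>i\<close>. Rank at most one kills the minors, making \<open>mul e v\<close> proportional
    to \<open>v\<close>.\<close>
  have minor: "(alg_mat mul v - 1\<^sub>m 4) $$ (0, j) * (alg_mat mul v - 1\<^sub>m 4) $$ (i, j') =
      (alg_mat mul v - 1\<^sub>m 4) $$ (0, j') * (alg_mat mul v - 1\<^sub>m 4) $$ (i, j)"
    if "0 < i" "i < 4" "j < j'" "j' < 4" for v i j j'
  proof (rule ccontr)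
    have A: "alg_mat mul w \<in> carrier_mat 4 4" for w by (simp add: alg_mat_def)
    assume "\<not> ?thesis"
    from vec_space.rank_ge_2[OF _ that this] have "2 \<le> vec_space.rank 4 (alg_mat mul v - 1\<^sub>m 4)"
      using A by (simp add: minus_carrier_mat)
    moreover have "vec_space.rank 4 (alg_mat mul v - 1\<^sub>m 4) \<le> 1"
      using max_rank_ge[of "alg_mat mul v" "range (alg_mat mul)" 3] A rank by (simp add: image_subset_iff del: split_paired_All)
    ultimately show False by simp
  qed
  have "mul e v = 0" if "e \<in> {e1, e2, e3}" for e v
  proof (cases "v = 0")
    case False
    have "\<exists>c. scl c v = mul e v"
      using that minor[of 1 1 2 v] minor[of 1 1 3 v] minor[of 1 2 3 v] minor[of 2 1 2 v] minor[of 2 1 3 v]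
        minor[of 2 2 3 v] minor[of 3 1 2 v] minor[of 3 1 3 v] minor[of 3 2 3 v]
      by (intro proportional[OF _ _ _ False]) (auto simp: alg_mat_def aff_mat_def)
    \<comment> \<open>Commutativity moves \<open>v\<close> to the left, where proportionality
      becomes an eigenvector equation.\<close>
    then obtain c where c: "scl c v = mul v e" using comm by metis
    then have "c = 0" using no_eigenvector False by blast
    then show ?thesis using c comm[of e v] by simp
  qed simp
  then have "alg_mat mul v = aff_mat v e1 e2 e3" for v
    by (simp add: alg_mat_def)
  then show ?thesis by (simp add: translation_subgroup_3)
qed

section \<open>The invariants $k$ and $d$\<close>

lemma (in vec_space) dim_span_vs_lin_indpt:
  assumes "S \<subseteq> carrier_vec n" "finite S" "lin_indpt S"
  shows "vectorspace.dim class_ring (V\<lparr>carrier := span S\<rparr>) = card S"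
proof -
  have "maximal S (\<lambda>T. T \<subseteq> S \<and> lin_indpt T)"
    using assms(3) unfolding maximal_def by blast
  from dim_span[OF _ assms(2) this] show ?thesis using assms(1) by simp
qed

lemma (in vec_space) lincomb_singleton:
  assumes "v \<in> carrier_vec n"
  shows "lincomb a {v} = a v \<cdot>\<^sub>v v"
  using assms by (simp add: lincomb_def)

lemma (in vec_space) lincomb_pair:
  assumes "v \<in> carrier_vec n" "w \<in> carrier_vec n" "v \<noteq> w"
  shows "lincomb a {v, w} = a v \<cdot>\<^sub>v v + a w \<cdot>\<^sub>v w"
  using assms by (simp add: lincomb_def)

lemma vec3_0: "vec3 0 = 0\<^sub>v 3"
  by (rule eq_vecI) (auto simp: less_3_iff)

lemma dim_line:
  assumes "(p :: 'a::field triple) \<noteq> 0"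
  shows "vectorspace.dim class_ring (module_vec TYPE('a) 3\<lparr>carrier := vec3 ` {scl a p | a. True}\<rparr>) = 1"
proof -
  interpret V: vec_space "TYPE('a)" 3 .
  have lc: "V.lincomb a {vec3 p} = vec3 (scl (a (vec3 p)) p)" for a
    by (simp add: V.lincomb_singleton vec3_scl)
  have "V.lin_indpt {vec3 p}"
    using assms by (intro V.finite_lin_indpt2) (simp_all add: lc vec3_0[symmetric])
  moreover have "V.span {vec3 p} = vec3 ` {scl a p | a. True}"
  proof -
    have "\<exists>f. vec3 (scl a p) = vec3 (scl (f (vec3 p)) p)" for a
      by (rule exI[of _ "\<lambda>_. a"]) simp
    then show ?thesis
      by (subst V.finite_span) (auto simp: lc)
  qed
  ultimately show ?thesis using V.dim_span_vs_lin_indpt[of "{vec3 p}"] by simp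
qed

lemma dim_plane:
  assumes ind: "\<And>a b. scl a p + scl b q = 0 \<Longrightarrow> a = 0 \<and> b = (0 :: 'a::field)"
  shows "vectorspace.dim class_ring
    (module_vec TYPE('a) 3\<lparr>carrier := vec3 ` {scl a p + scl b q | a b. True}\<rparr>) = 2"
proof -
  interpret V: vec_space "TYPE('a)" 3 .
  have "p \<noteq> q" using ind[of 1 "-1"] by (auto simp: triple.scale_minus_left)
  then have pq: "vec3 p \<noteq> vec3 q" by simp
  have lc: "V.lincomb a {vec3 p, vec3 q} = vec3 (scl (a (vec3 p)) p + scl (a (vec3 q)) q)" for a
    using pq by (simp add: V.lincomb_pair vec3_scl vec3_add)
  have "V.lin_indpt {vec3 p, vec3 q}"
    using ind by (intro V.finite_lin_indpt2) (auto simp: lc vec3_0[symmetric])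
  moreover have "V.span {vec3 p, vec3 q} = vec3 ` {scl a p + scl b q | a b. True}"
  proof -
    \<comment> \<open>Coefficients are functions of vectors here, so prescribing \<open>a\<close>
      and \<open>b\<close> separately requires \<open>vec3 p\<close> and \<open>vec3 q\<close> to be
      distinct.\<close>
    have "\<exists>f. vec3 (scl a p + scl b q) = vec3 (scl (f (vec3 p)) p + scl (f (vec3 q)) q)" for a b
      by (rule exI[of _ "\<lambda>v. if v = vec3 p then a else b"]) (use pq in simp)
    then show ?thesis
      by (subst V.finite_span) (auto simp: lc)
  qed
  ultimately show ?thesis using V.dim_span_vs_lin_indpt[of "{vec3 p, vec3 q}"] pq by simp
qed

lemma sum_lessThan_3: "(\<Sum>i\<in>{0..<3::nat}. f i) = f 0 + f 1 + (f 2 :: 'a::comm_monoid_add)"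
  by (simp add: numeral_eq_Suc add.assoc)

lemma mat_of_row_lin_part:
  "mat_of_row (vec3 x) * lin_part (aff_mat v p q r) = mat_of_row (vec3 (lc x p q r))"
proof (rule eq_matI)
  fix i j assume "i < dim_row (mat_of_row (vec3 (lc x p q r)))" "j < dim_col (mat_of_row (vec3 (lc x p q r)))"
  then have "i = 0" "j = 0 \<or> j = 1 \<or> j = 2" by (auto simp: mat_of_row_def)
  then show "(mat_of_row (vec3 x) * lin_part (aff_mat v p q r)) $$ (i, j) = mat_of_row (vec3 (lc x p q r)) $$ (i, j)"
    by (auto simp: lin_part_aff_mat mat_of_row_def mat_of_rows_list_def scalar_prod_def sum_lessThan_3
        lc_def scl_def vec3_index(3)[unfolded numeral_2_eq_2])
qed (auto simp: lin_part_aff_mat mat_of_row_def mat_of_rows_list_def)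

context triple_algebra
begin

text \<open>The linear part of the element for \<open>v\<close> sends \<open>x\<close> to
  \<open>x + mul x v\<close>, so being fixed by the whole group means being annihilated from the
  left side of the product.\<close>

lemma fix_space_alg: "fix_space 3 (range (alg_mat mul)) = vec3 ` {x. \<forall>v. mul x v = 0}"
proof -
  have row: "mat_of_row (vec3 x) * lin_part (alg_mat mul v) = mat_of_row (vec3 (x + mul x v))" for x v
    unfolding alg_mat_def mat_of_row_lin_part lc_alg_mat ..
  have inj: "mat_of_row v = mat_of_row w \<longleftrightarrow> v = w" for v w :: "'a vec"
    by (metis row_mat_of_row)
  have mem: "vec3 x \<in> fix_space 3 (range (alg_mat mul)) \<longleftrightarrow> (\<forall>v. mul x v = 0)" for x
    by (simp add: fix_space_def row inj del: split_paired_All)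
  show ?thesis
  proof (intro equalityI subsetI)
    fix w assume w: "w \<in> fix_space 3 (range (alg_mat mul))"
    then have "w \<in> carrier_vec 3" by (simp add: fix_space_def)
    from vec3_surj[OF this] obtain x where "w = vec3 x" by blast
    then show "w \<in> vec3 ` {x. \<forall>v. mul x v = 0}" using w mem by blast
  qed (use mem in blast)
qed

text \<open>Testing against \<open>p\<close> and \<open>q\<close> suffices; the condition says that
  the row \<open>(a, b)\<close> lies in the left kernel of the Gram matrix.\<close>

lemma form_basis_left_annihilator:
  assumes fb: "form_basis mul b11 b12 b21 b22 p q r"
  shows "(\<forall>v. mul (scl a p + scl b q + scl c r) v = 0) \<longleftrightarrow>
    a * b11 + b * b21 = 0 \<and> a * b12 + b * b22 = 0"
proof -
  have ind: "indep p q r" using fb by (simp add: form_basis_def)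
  have "r \<noteq> 0" using indepD[OF ind, of 0 0 1] by auto
  then have r: "scl d r = 0 \<longleftrightarrow> d = 0" for d by simp
  show ?thesis
  proof
    assume 0: "\<forall>v. mul (scl a p + scl b q + scl c r) v = 0"
    show "a * b11 + b * b21 = 0 \<and> a * b12 + b * b22 = 0"
      using form_basis_mul[OF fb, of a b c 1 0 0] form_basis_mul[OF fb, of a b c 0 1 0]
      unfolding 0[rule_format] r[of "_ + _"] eq_commute[of 0] by simp
  next
    assume 0: "a * b11 + b * b21 = 0 \<and> a * b12 + b * b22 = 0"
    show "\<forall>v. mul (scl a p + scl b q + scl c r) v = 0"
    proof
      fix v
      obtain a' b' c' where v: "v = scl a' p + scl b' q + scl c' r" using indep_span[OF ind] .
      have "a * (b11 * a' + b12 * b') + b * (b21 * a' + b22 * b') =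
        (a * b11 + b * b21) * a' + (a * b12 + b * b22) * b'" by (simp add: algebra_simps)
      then show "mul (scl a p + scl b q + scl c r) v = 0"
        unfolding v form_basis_mul[OF fb] using 0 by simp
    qed
  qed
qed

lemma fix_dim_nondegenerate:
  assumes fb: "form_basis mul b11 b12 b21 b22 p q r" and det: "b11 * b22 - b12 * b21 \<noteq> 0"
  shows "fix_dim 3 (range (alg_mat mul)) = 1"
proof -
  have ind: "indep p q r" using fb by (simp add: form_basis_def)
  have ann: "{x. \<forall>v. mul x v = 0} = {scl c r | c. True}"
  proof (intro equalityI subsetI)
    fix x assume x: "x \<in> {x. \<forall>v. mul x v = 0}"
    obtain a b c where x': "x = scl a p + scl b q + scl c r" using indep_span[OF ind] .
    have 0: "a * b11 + b * b21 = 0" "a * b12 + b * b22 = 0"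
      using x unfolding x' mem_Collect_eq form_basis_left_annihilator[OF fb] by auto
    have "a * (b11 * b22 - b12 * b21) = (a * b11 + b * b21) * b22 - (a * b12 + b * b22) * b21"
      "b * (b11 * b22 - b12 * b21) = (a * b12 + b * b22) * b11 - (a * b11 + b * b21) * b12"
      by (simp_all add: algebra_simps)
    then have "a = 0" "b = 0" using 0 det by auto
    then show "x \<in> {scl c r | c. True}" unfolding x' by auto
  next
    fix x assume "x \<in> {scl c r | c. True}"
    then obtain c where "x = scl 0 p + scl 0 q + scl c r" by auto
    then show "x \<in> {x. \<forall>v. mul x v = 0}"
      using form_basis_left_annihilator[OF fb, of 0 0 c] by simp
  qed
  have "r \<noteq> 0" using indepD[OF ind, of 0 0 1] by auto
  then show ?thesis unfolding fix_dim_def fix_space_alg ann by (rule dim_line)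
qed

lemma fix_dim_N1:
  assumes fb: "form_basis mul 0 0 1 0 p q r"
  shows "fix_dim 3 (range (alg_mat mul)) = 2"
proof -
  have ind: "indep p q r" using fb by (simp add: form_basis_def)
  have ann: "{x. \<forall>v. mul x v = 0} = {scl a p + scl c r | a c. True}"
  proof (intro equalityI subsetI)
    fix x assume x: "x \<in> {x. \<forall>v. mul x v = 0}"
    obtain a b c where x': "x = scl a p + scl b q + scl c r" using indep_span[OF ind] .
    have "b = 0"
      using x unfolding x' mem_Collect_eq form_basis_left_annihilator[OF fb] by auto
    then show "x \<in> {scl a p + scl c r | a c. True}" unfolding x' by auto
  next
    fix x assume "x \<in> {scl a p + scl c r | a c. True}"
    then obtain a c where "x = scl a p + scl 0 q + scl c r" by auto
    then show "x \<in> {x. \<forall>v. mul x v = 0}"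
      using form_basis_left_annihilator[OF fb, of a 0 c] by simp
  qed
  have "a = 0 \<and> c = 0" if "scl a p + scl c r = 0" for a c
    using indepD[OF ind, of a 0 c] that by simp
  then show ?thesis unfolding fix_dim_def fix_space_alg ann by (rule dim_plane)
qed

end

section \<open>Minimal polynomials of nilpotent matrices and the invariant d\<close>

lemma pow_mat_add:
  assumes "A \<in> carrier_mat n n"
  shows "A ^\<^sub>m (k + l) = A ^\<^sub>m k * (A ^\<^sub>m l :: 'a::semiring_1 mat)"
proof (induction l)
  case (Suc l)
  then show ?case using assms by (simp add: assoc_mult_mat[of _ n n _ n _ n] pow_carrier_mat)
qed (use assms in \<open>simp add: right_mult_one_mat[of _ n n] pow_carrier_mat\<close>)

text \<open>An arbitrary bound \<open>N\<close> allows polynomials of different degrees to be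
  compared over a common range of summation.\<close>

lemma poly_mat_index:
  assumes "A \<in> carrier_mat n n" "i < n" "j < n" "degree p \<le> N"
  shows "poly_mat p A $$ (i, j) = (\<Sum>l\<le>N. coeff p l * (A ^\<^sub>m l) $$ (i, j))"
proof -
  have "(\<Sum>l\<le>N. coeff p l * (A ^\<^sub>m l) $$ (i, j)) = (\<Sum>l\<le>degree p. coeff p l * (A ^\<^sub>m l) $$ (i, j))"
    using assms(4) by (intro sum.mono_neutral_right) (auto simp: coeff_eq_0)
  then show ?thesis using assms by (simp add: poly_mat_def)
qed

lemma poly_mat_eq_0_iff:
  assumes A: "A \<in> carrier_mat n n" and N: "degree p \<le> N"
  shows "poly_mat p A = 0\<^sub>m (dim_row A) (dim_row A) \<longleftrightarrow>
    (\<forall>i<n. \<forall>j<n. (\<Sum>l\<le>N. coeff p l * (A ^\<^sub>m l) $$ (i, j)) = 0)"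
proof -
  have "poly_mat p A \<in> carrier_mat n n" using A by (simp add: poly_mat_def)
  then show ?thesis
    using A poly_mat_index[OF A _ _ N] by (auto simp: mat_eq_iff)
qed

text \<open>If the lowest nonzero coefficient of \<open>q\<close> sat in degree
  \<open>m < k\<close>, multiplying \<open>q(A)\<close> by the power \<open>k - 1 - m\<close> of
  \<open>A\<close> would turn its lowest term into a nonzero multiple of
  \<open>A ^\<^sub>m (k - 1)\<close> and kill all others.\<close>

lemma degree_ge_of_annihilates_nilpotent:
  assumes A: "A \<in> carrier_mat n n" and k: "A ^\<^sub>m k = 0\<^sub>m n n" "A ^\<^sub>m (k - 1) \<noteq> 0\<^sub>m n n"
    and q: "q \<noteq> 0" "poly_mat q A = 0\<^sub>m (dim_row A) (dim_row A)"
  shows "k \<le> degree q"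
proof (rule ccontr)
  assume "\<not> k \<le> degree q"
  define m where "m = (LEAST m. coeff q m \<noteq> 0)"
  have m: "coeff q m \<noteq> 0" unfolding m_def by (rule LeastI[of "\<lambda>m. coeff q m \<noteq> 0" "degree q"]) (simp add: q(1))
  have less_m: "coeff q l = 0" if "l < m" for l
    using not_less_Least[of l "\<lambda>m. coeff q m \<noteq> 0"] that by (auto simp: m_def)
  have mk: "m \<le> degree q" "m < k" using le_degree[OF m] \<open>\<not> k \<le> degree q\<close> by auto
  define s where "s = k - 1 - m"
  have ms: "m + s = k - 1" using mk by (simp add: s_def)
  have pow0: "A ^\<^sub>m (l + s) = 0\<^sub>m n n" if "m < l" for l
  proof -
    have *: "k + (l + s - k) = l + s" using that mk by (simp add: s_def)
    have "A ^\<^sub>m (l + s) = A ^\<^sub>m k * A ^\<^sub>m (l + s - k)" using pow_mat_add[OF A, of k "l + s - k"] unfolding * .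
    then show ?thesis using A k(1) by (simp add: left_mult_zero_mat[of _ n n] pow_carrier_mat)
  qed
  have "(A ^\<^sub>m (k - 1)) $$ (i, j) = 0" if ij: "i < n" "j < n" for i j
  proof -
    have pow: "(A ^\<^sub>m (l + s)) $$ (i, j) = (\<Sum>t<n. (A ^\<^sub>m l) $$ (i, t) * (A ^\<^sub>m s) $$ (t, j))" for l
      using A ij unfolding pow_mat_add[OF A]
      by (simp add: scalar_prod_def lessThan_atLeast0 carrier_matD[OF pow_carrier_mat[OF A]])
    have "(\<Sum>t<n. (\<Sum>l\<le>degree q. coeff q l * (A ^\<^sub>m l) $$ (i, t)) * (A ^\<^sub>m s) $$ (t, j)) =
        (\<Sum>l\<le>degree q. coeff q l * (A ^\<^sub>m (l + s)) $$ (i, j))"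
      unfolding pow sum_distrib_right sum_distrib_left by (subst sum.swap) (simp add: mult.assoc)
    also have "\<dots> = (\<Sum>l\<in>{m}. coeff q l * (A ^\<^sub>m (l + s)) $$ (i, j))"
    proof (intro sum.mono_neutral_right ballI)
      fix l assume "l \<in> {..degree q} - {m}"
      then show "coeff q l * (A ^\<^sub>m (l + s)) $$ (i, j) = 0"
        using less_m[of l] pow0[of l] ij by (cases "l < m") auto
    qed (use mk in auto)
    finally have "coeff q m * (A ^\<^sub>m (k - 1)) $$ (i, j) = 0"
      using q(2) ij unfolding poly_mat_eq_0_iff[OF A order_refl] by (simp add: ms)
    then show ?thesis using m by simp
  qed
  then have "A ^\<^sub>m (k - 1) = 0\<^sub>m n n"
    using pow_carrier_mat[OF A, of "k - 1"] by (intro eq_matI) auto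
  then show False using k(2) by simp
qed

lemma degree_min_poly_nilpotent:
  assumes A: "(A :: 'a::field mat) \<in> carrier_mat n n"
    and k: "A ^\<^sub>m k = 0\<^sub>m n n" "A ^\<^sub>m (k - 1) \<noteq> 0\<^sub>m n n"
  shows "degree (min_poly A) = k"
proof -
  let ?Z = "\<lambda>p. poly_mat p A = 0\<^sub>m (dim_row A) (dim_row A)"
  let ?X = "monom (1 :: 'a) k"
  have "(\<Sum>l\<le>k. coeff ?X l * (A ^\<^sub>m l) $$ (i, j)) = (\<Sum>l\<le>k. if l = k then (A ^\<^sub>m k) $$ (i, j) else 0)" for i j
    by (intro sum.cong) auto
  then have X: "?Z ?X"
    unfolding poly_mat_eq_0_iff[OF A degree_monom_le] using k(1) by simp
  note ge = degree_ge_of_annihilates_nilpotent[OF A k]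
  have "min_poly A = ?X"
    unfolding min_poly_def
  proof (rule the_equality)
    show "lead_coeff ?X = 1 \<and> ?Z ?X \<and> (\<forall>q. q \<noteq> 0 \<and> ?Z q \<longrightarrow> degree ?X \<le> degree q)"
      using X ge by (simp add: degree_monom_eq)
  next
    fix p assume p: "lead_coeff p = 1 \<and> ?Z p \<and> (\<forall>q. q \<noteq> 0 \<and> ?Z q \<longrightarrow> degree p \<le> degree q)"
    have "p \<noteq> 0" using p by auto
    then have "k \<le> degree p" using ge p by blast
    moreover have "degree p \<le> k" using p X by (metis degree_monom_eq monom_eq_0_iff zero_neq_one)
    ultimately have deg: "degree p = k" by simp
    show "p = ?X"
    \<comment> \<open>Uniqueness is needed for the definite description in \<open>min_poly\<close>:
      two monic annihilators of degree \<open>k\<close> differ by an annihilator whose coefficient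
      at \<open>k\<close> cancels.\<close>
    proof (rule ccontr)
      assume ne: "p \<noteq> ?X"
      have le: "degree (p - ?X) \<le> k" using deg by (intro degree_diff_le) (auto simp: degree_monom_le)
      have "?Z (p - ?X)"
        using p X deg unfolding poly_mat_eq_0_iff[OF A le] poly_mat_eq_0_iff[OF A degree_monom_le]
          poly_mat_eq_0_iff[OF A eq_refl[OF deg]]
        by (simp only: coeff_diff left_diff_distrib sum_subtractf) simp
      then have "k \<le> degree (p - ?X)" using ge ne by simp
      then have "coeff (p - ?X) k \<noteq> 0" using le ne by (metis eq_iff_diff_eq_0 leading_coeff_0_iff le_antisym)
      then show False using p deg by simp
    qed
  qed
  then show ?thesis by (simp add: degree_monom_eq)
qed

definition nil_mat :: "'a::field triple \<Rightarrow> 'a triple \<Rightarrow> 'a triple \<Rightarrow> 'a triple \<Rightarrow> 'a mat" where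
  "nil_mat v p q r = mat_of_rows_list 4
     [[0, fst v, fst (snd v), snd (snd v)], [0, fst p, fst (snd p), snd (snd p)],
      [0, fst q, fst (snd q), snd (snd q)], [0, fst r, fst (snd r), snd (snd r)]]"

lemma nil_mat_carrier [simp]: "nil_mat v p q r \<in> carrier_mat 4 4"
  by (simp add: nil_mat_def)

lemma nil_mat_mult:
  "nil_mat v p q r * nil_mat v' p' q' r' = nil_mat (lc v p' q' r') (lc p p' q' r') (lc q p' q' r') (lc r p' q' r')"
proof (rule eq_mat_4I)
  fix i j :: nat assume ij: "i \<in> {0, 1, 2, 3}" "j \<in> {0, 1, 2, 3}"
  then have "i < 4" "j < 4" by auto
  with ij show "(nil_mat v p q r * nil_mat v' p' q' r') $$ (i, j) =
    nil_mat (lc v p' q' r') (lc p p' q' r') (lc q p' q' r') (lc r p' q' r') $$ (i, j)"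
    unfolding mult_4_index[OF nil_mat_carrier nil_mat_carrier \<open>i < 4\<close> \<open>j < 4\<close>]
    by (auto simp: nil_mat_def lc_def scl_def)
qed (simp_all add: mult_carrier_mat[OF nil_mat_carrier nil_mat_carrier])

lemma nil_mat_eq_0: "nil_mat v p q r = 0\<^sub>m 4 4 \<longleftrightarrow> v = 0 \<and> p = 0 \<and> q = 0 \<and> r = 0"
proof
  assume eq: "nil_mat v p q r = 0\<^sub>m 4 4"
  have "nil_mat v p q r $$ (i, j) = 0\<^sub>m 4 4 $$ (i, j)" for i j
    using eq by simp
  from this[of 0 1] this[of 0 2] this[of 0 3] this[of 1 1] this[of 1 2] this[of 1 3]
    this[of 2 1] this[of 2 2] this[of 2 3] this[of 3 1] this[of 3 2] this[of 3 3]
  show "v = 0 \<and> p = 0 \<and> q = 0 \<and> r = 0"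
    by (simp add: nil_mat_def prod_eq_iff)
next
  assume "v = 0 \<and> p = 0 \<and> q = 0 \<and> r = 0"
  then show "nil_mat v p q r = 0\<^sub>m 4 4"
    by (intro eq_mat_4I) (auto simp: nil_mat_def)
qed

context triple_algebra
begin

text \<open>The matrix has rows \<open>v\<close> and \<open>mul e v\<close> for unit vectors
  \<open>e\<close>. Its square has first row \<open>mul v v\<close> and no others, since products of
  three elements vanish, and its cube is 0. The value 1 belongs to the zero matrix, with minimal
  polynomial X.\<close>

lemma degree_min_poly_alg:
  assumes nil: "\<And>x y z. mul (mul x y) z = 0"
  shows "degree (min_poly (alg_mat mul v - 1\<^sub>m (3 + 1))) = (if v = 0 then 1 else if mul v v = 0 then 2 else 3)"
proof -
  let ?A = "nil_mat v (mul e1 v) (mul e2 v) (mul e3 v)"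
  have A: "alg_mat mul v - 1\<^sub>m (3 + 1) = ?A"
    by (rule eq_mat_4I) (auto simp: alg_mat_def aff_mat_def nil_mat_def minus_carrier_mat)
  have A1: "?A ^\<^sub>m 1 = ?A" by (simp add: left_mult_one_mat[OF nil_mat_carrier] carrier_matD[OF nil_mat_carrier])
  have A2: "?A ^\<^sub>m 2 = nil_mat (mul v v) 0 0 0"
    using A1 by (simp add: numeral_2_eq_2 nil_mat_mult lc_mul nil)
  have A3: "?A ^\<^sub>m 3 = 0\<^sub>m 4 4"
    using A2 by (simp add: numeral_3_eq_3 numeral_2_eq_2 nil_mat_mult lc_mul nil nil_mat_eq_0)
  have A0: "?A ^\<^sub>m 0 \<noteq> 0\<^sub>m 4 4"
  proof
    assume "?A ^\<^sub>m 0 = 0\<^sub>m 4 4"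
    then have "(1\<^sub>m 4 :: 'a mat) $$ (0, 0) = 0\<^sub>m 4 4 $$ (0, 0)" by (simp add: carrier_matD[OF nil_mat_carrier])
    then show False by simp
  qed
  note deg = degree_min_poly_nilpotent[OF nil_mat_carrier]
  show ?thesis
    unfolding A
    using deg[of v "mul e1 v" "mul e2 v" "mul e3 v" 1] deg[of v "mul e1 v" "mul e2 v" "mul e3 v" 2]
      deg[of v "mul e1 v" "mul e2 v" "mul e3 v" 3] A0
    unfolding A1 A2 A3 by (auto simp: nil_mat_eq_0 A1[simplified] A2[simplified])
qed

lemma max_deg_alg:
  assumes nil: "\<And>x y z. mul (mul x y) z = 0"
  shows "max_deg 3 (range (alg_mat mul)) = (if \<exists>v. mul v v \<noteq> 0 then 3 else 2)"
  unfolding max_deg_def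
proof (rule Max_eqI)
  let ?d = "\<lambda>h :: 'a mat. degree (min_poly (h - 1\<^sub>m (3 + 1)))"
  let ?m = "if \<exists>v. mul v v \<noteq> 0 then 3 else 2 :: nat"
  note deg = degree_min_poly_alg[OF nil]
  show "finite (?d ` range (alg_mat mul))"
    by (rule finite_subset[of _ "{1, 2, 3}"]) (auto simp only: deg split: if_splits)
  show "y \<le> ?m" if y: "y \<in> ?d ` range (alg_mat mul)" for y
  proof -
    obtain v where "y = ?d (alg_mat mul v)" using y by blast
    then have y': "y = (if v = 0 then 1 else if mul v v = 0 then 2 else 3)" unfolding deg .
    show ?thesis
    proof (cases "mul v v = 0")
      case True
      then show ?thesis unfolding y' by simp
    next
      case False
      then have "\<exists>v. mul v v \<noteq> 0" by blast
      then show ?thesis unfolding y' by (simp del: split_paired_Ex)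
    qed
  qed
  show "?m \<in> ?d ` range (alg_mat mul)"
  proof (cases "\<exists>v. mul v v \<noteq> 0")
    case True
    then obtain v where v: "mul v v \<noteq> 0" by blast
    then have "v \<noteq> 0" by auto
    then have "?d (alg_mat mul v) = ?m" unfolding deg using v True by simp
    then show ?thesis by (intro image_eqI[of _ _ "alg_mat mul v"] rangeI) (simp only:)
  next
    case False
    have "e1 \<noteq> (0 :: 'a triple)" by (simp add: zero_prod_def)
    then have "?d (alg_mat mul e1) = ?m" unfolding deg using False by (simp del: split_paired_Ex)
    then show ?thesis by (intro image_eqI[of _ _ "alg_mat mul e1"] rangeI) (simp only:)
  qed
qed

end

text \<open>\<open>fix_dim\<close> separates \<open>N1\<close> from the others,
  \<open>max_deg\<close> separates \<open>N2\<close> from the \<open>N3 l\<close>, and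
  \<open>form_basis_invariant\<close> separates the \<open>N3 l\<close> from each other.\<close>

lemma classification:
  assumes reg: "regular 3 U" and lin: "delta_linear 3 (U :: 'a::field mat set)"
    and rank: "max_rank 3 (center 3 U) = 1"
  shows "abelian 3 U \<Longrightarrow> U = translation_subgroup 3"
    and "\<not> abelian 3 U \<Longrightarrow> (\<exists>!M. M \<in> {N1, N2} \<union> {N3 l | l. l \<noteq> 0} \<and> AGL_conj 3 U M)"
    and "\<not> abelian 3 U \<Longrightarrow> AGL_conj 3 U N1 \<longleftrightarrow> fix_dim 3 U = 2"
    and "\<not> abelian 3 U \<Longrightarrow> AGL_conj 3 U N2 \<longleftrightarrow> fix_dim 3 U = 1 \<and> max_deg 3 U = 2 \<and> CHAR('a) \<noteq> 2"
    and "\<not> abelian 3 U \<Longrightarrow> (\<exists>l. l \<noteq> 0 \<and> AGL_conj 3 U (N3 l)) \<longleftrightarrow> fix_dim 3 U = 1 \<and> max_deg 3 U = 3"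
proof -
  define mul where "mul = delta_mul U"
  interpret quasiregular_algebra mul
    unfolding mul_def using regular_linear_algebra(1)[OF reg lin] .
  have U: "U = range (alg_mat mul)"
    unfolding mul_def using regular_linear_algebra(2)[OF reg lin] .
  have sub: "subgroup U (AGL 3)" using reg by (simp add: regular_def)
  have ab: "abelian 3 U \<longleftrightarrow> (\<forall>v w. mul v w = mul w v)"
    unfolding abelian_iff[OF sub] unfolding U by (simp add: alg_mat_commute del: split_paired_All)
  show "U = translation_subgroup 3" if abel: "abelian 3 U"
  proof -
    \<comment> \<open>The rank bound, stated for the center, thus holds for all of
      \<open>U\<close>.\<close>
    have "center 3 U = U"
      using abel unfolding abelian_iff[OF sub] center_def by auto
    with rank have "max_rank 3 (range (alg_mat mul)) = 1" by (simp add: U)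
    moreover have "mul v w = mul w v" for v w using abel unfolding ab by blast
    ultimately show ?thesis unfolding U by (rule commutative_max_rank_1[rotated])
  qed
  assume nab: "\<not> abelian 3 U"
  then obtain x y where xy: "mul x y \<noteq> mul y x" unfolding ab by blast
  note nil = nilpotent_noncommutative[OF xy]
  define fb where "fb b11 b12 b21 b22 \<longleftrightarrow> (\<exists>p q r. form_basis mul b11 b12 b21 b22 p q r)" for b11 b12 b21 b22
  have conj: "AGL_conj 3 U (form_group b11 b12 b21 b22) \<longleftrightarrow> fb b11 b12 b21 b22" for b11 b12 b21 b22
    unfolding fb_def U using form_basis_imp_conj conj_imp_form_basis[OF nil] by blast
  have deg: "max_deg 3 U = (if \<exists>v. mul v v \<noteq> 0 then 3 else 2)"
    unfolding U by (rule max_deg_alg[OF nil])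
  have type1: "fix_dim 3 U = 2" if "fb 0 0 1 0"
    using that unfolding fb_def U by (metis fix_dim_N1)
  have type2: "fix_dim 3 U = 1 \<and> max_deg 3 U = 2 \<and> CHAR('a) \<noteq> 2" if fb2: "fb 0 (- 1) 1 0"
  proof -
    obtain p q r where b: "form_basis mul 0 (- 1) 1 0 p q r" using fb2 unfolding fb_def by blast
    then have ind: "indep p q r" by (simp add: form_basis_def)
    have "mul v v = 0" for v
    proof -
      obtain a b' c where "v = scl a p + scl b' q + scl c r" using indep_span[OF ind] .
      then show ?thesis using form_basis_mul[OF b] by simp
    qed
    \<comment> \<open>If -1 = 1, the Gram matrix is symmetric and the product would commute.\<close>
    moreover have "CHAR('a) \<noteq> 2"
    proof
      assume "CHAR('a) = 2"
      then have "(2 :: 'a) = 0" using of_nat_CHAR[where ?'a = 'a] by simp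
      then have m1: "(- 1 :: 'a) = 1" by (metis add_eq_0_iff one_add_one)
      obtain a b' c where x: "x = scl a p + scl b' q + scl c r" using indep_span[OF ind] .
      obtain d e f where y: "y = scl d p + scl e q + scl f r" using indep_span[OF ind] .
      have "mul x y = mul y x"
        unfolding x y form_basis_mul[OF b] m1 by (simp add: ac_simps)
      then show False using xy by simp
    qed
    moreover have "fix_dim 3 U = 1" unfolding U by (rule fix_dim_nondegenerate[OF b]) simp
    ultimately show ?thesis by (simp add: deg del: split_paired_Ex split_paired_All)
  qed
  have type3: "fix_dim 3 U = 1 \<and> max_deg 3 U = 3" if fb3: "fb 1 1 0 l" "l \<noteq> 0" for l
  proof -
    obtain p q r where b: "form_basis mul 1 1 0 l p q r" using fb3(1) unfolding fb_def by blast
    then have ind: "indep p q r" by (simp add: form_basis_def)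
    have "r \<noteq> 0" using indepD[OF ind, of 0 0 1] by auto
    then have "mul p p \<noteq> 0" using b by (simp add: form_basis_def)
    then have "\<exists>v. mul v v \<noteq> 0" by blast
    moreover have "fix_dim 3 U = 1" unfolding U by (rule fix_dim_nondegenerate[OF b]) (simp add: fb3)
    ultimately show ?thesis by (simp add: deg del: split_paired_Ex)
  qed
  have ex: "fb 0 0 1 0 \<or> fb 0 (- 1) 1 0 \<or> (\<exists>l. l \<noteq> 0 \<and> fb 1 1 0 l)"
  proof -
    obtain p q r where "form_basis mul 0 0 1 0 p q r \<or> form_basis mul 0 (- 1) 1 0 p q r \<or>
        (\<exists>l. l \<noteq> 0 \<and> form_basis mul 1 1 0 l p q r)"
      using normal_form[OF xy] by (elim exE)
    then show ?thesis unfolding fb_def by (elim disjE exE conjE) blast+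
  qed
  have uniq: "l = m" if "fb 1 1 0 l" "fb 1 1 0 m" for l m
    using that form_basis_invariant unfolding fb_def by blast
  note conj_N = N_eq_form_group conj
  \<comment> \<open>The types exhaust all cases, so each converse only excludes the other two by
    their invariants.\<close>
  show "AGL_conj 3 U N1 \<longleftrightarrow> fix_dim 3 U = 2"
  proof
    assume d: "fix_dim 3 U = 2"
    have "\<not> fb 0 (- 1) 1 0" using type2 d by linarith
    moreover have "\<not> (\<exists>l. l \<noteq> 0 \<and> fb 1 1 0 l)" using type3 d by fastforce
    ultimately show "AGL_conj 3 U N1" unfolding conj_N using ex by blast
  qed (simp add: conj_N type1)
  show "AGL_conj 3 U N2 \<longleftrightarrow> fix_dim 3 U = 1 \<and> max_deg 3 U = 2 \<and> CHAR('a) \<noteq> 2"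
  proof
    assume d: "fix_dim 3 U = 1 \<and> max_deg 3 U = 2 \<and> CHAR('a) \<noteq> 2"
    have "\<not> fb 0 0 1 0" using type1 d by linarith
    moreover have "\<not> (\<exists>l. l \<noteq> 0 \<and> fb 1 1 0 l)" using type3 d by fastforce
    ultimately show "AGL_conj 3 U N2" unfolding conj_N using ex by blast
  qed (simp add: conj_N type2)
  show "(\<exists>l. l \<noteq> 0 \<and> AGL_conj 3 U (N3 l)) \<longleftrightarrow> fix_dim 3 U = 1 \<and> max_deg 3 U = 3"
  proof
    assume d: "fix_dim 3 U = 1 \<and> max_deg 3 U = 3"
    have "\<not> fb 0 0 1 0" using type1 d by linarith
    moreover have "\<not> fb 0 (- 1) 1 0" using type2 d by linarith
    ultimately show "\<exists>l. l \<noteq> 0 \<and> AGL_conj 3 U (N3 l)" unfolding conj_N using ex by blast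
  next
    assume "\<exists>l. l \<noteq> 0 \<and> AGL_conj 3 U (N3 l)"
    then obtain l where "l \<noteq> 0" "fb 1 1 0 l" unfolding conj_N by blast
    then show "fix_dim 3 U = 1 \<and> max_deg 3 U = 3" using type3 by blast
  qed
  show "\<exists>!M. M \<in> {N1, N2} \<union> {N3 l | l. l \<noteq> 0} \<and> AGL_conj 3 U M"
  proof (rule ex_ex1I)
    show "\<exists>M. M \<in> {N1, N2} \<union> {N3 l | l. l \<noteq> 0} \<and> AGL_conj 3 U M"
      using ex unfolding conj[symmetric] N_eq_form_group[symmetric] by blast
  next
    fix M M'
    have cases: "M = N1 \<and> fb 0 0 1 0 \<or> M = N2 \<and> fb 0 (- 1) 1 0 \<or> (\<exists>l. l \<noteq> 0 \<and> M = N3 l \<and> fb 1 1 0 l)"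
      if "M \<in> {N1, N2} \<union> {N3 l | l. l \<noteq> 0} \<and> AGL_conj 3 U M" for M
      using that unfolding conj[symmetric] N_eq_form_group[symmetric] by blast
    assume "M \<in> {N1, N2} \<union> {N3 l | l. l \<noteq> 0} \<and> AGL_conj 3 U M"
      "M' \<in> {N1, N2} \<union> {N3 l | l. l \<noteq> 0} \<and> AGL_conj 3 U M'"
    note this[THEN cases]
    moreover have "\<not> (fb 0 0 1 0 \<and> fb 0 (- 1) 1 0)" using type1 type2 by linarith
    moreover have "\<not> (fb 0 0 1 0 \<and> fb 1 1 0 l)" "\<not> (fb 0 (- 1) 1 0 \<and> fb 1 1 0 l)" if "l \<noteq> 0" for l
      using type1 type2 type3[OF _ that] by fastforce+
    ultimately show "M = M'" using uniq by metis
  qed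
qed

section \<open>The presentations\<close>

lemma poly_mapping_single_add_induct [case_names single add]:
  fixes p :: "'k \<Rightarrow>\<^sub>0 'b::comm_monoid_add"
  assumes single: "\<And>k c. P (Poly_Mapping.single k c)"
    and add: "\<And>p q. P p \<Longrightarrow> P q \<Longrightarrow> P (p + q)"
  shows "P p"
proof (induction p rule: update_induct)
  case const
  show ?case using single[of undefined 0] by simp
next
  case (update p k c)
  have "Poly_Mapping.update k c p = Poly_Mapping.single k c + p"
    using update(1) by (intro poly_mapping_eqI) (auto simp: lookup_update lookup_add lookup_single in_keys_iff)
  then show ?case using single add update by metis
qed

lemma scal_mult: "scal c * Poly_Mapping.single k d = Poly_Mapping.single k (c * d)"
  by (simp add: scal_def mult_single)

lemma scal_simps: "scal c * scal d = scal (c * d)" "scal 1 = 1" "scal 0 = 0" "scal (c + d) = scal c + scal d"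
  "scal (- c) = - scal c"
  by (simp_all add: scal_def mult_single single_add single_uminus)

lemma scal_central: "scal c * p = p * scal c"
  by (induction p rule: poly_mapping_single_add_induct)
    (simp_all add: scal_def mult_single mult.commute algebra_simps)

abbreviation word :: "('g, 'a::field) free_alg \<Rightarrow> 'g list \<Rightarrow> 'a" where
  "word p ws \<equiv> Poly_Mapping.lookup p (FreeMon ws)"

text \<open>Both sides are additive in \<open>p\<close> and in \<open>q\<close>, so single monomials
  suffice; for these, only the cut at the length of the left word contributes.\<close>

lemma word_mult:
  "word (p * q) ws = (\<Sum>i\<le>length ws. word p (take i ws) * word q (drop i ws))"
proof (induction p rule: poly_mapping_single_add_induct)
  case (single k a)
  show ?case
  proof (induction q rule: poly_mapping_single_add_induct)
    case (single l b)
    obtain us vs where k: "k = FreeMon us" and l: "l = FreeMon vs" by (metis free_mon.exhaust)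
    have "(\<Sum>i\<le>length ws. word (Poly_Mapping.single k a) (take i ws) * word (Poly_Mapping.single l b) (drop i ws)) =
      (\<Sum>i\<le>length ws. if i = length us then (if us @ vs = ws then a * b else 0) else 0)"
    proof (rule sum.cong)
      fix i assume "i \<in> {..length ws}"
      then have "length (take i ws) = i" by simp
      then have iff: "us = take i ws \<and> vs = drop i ws \<longleftrightarrow> i = length us \<and> us @ vs = ws"
        using append_take_drop_id[of i ws] by (auto simp del: append_take_drop_id length_take)
      have "word (Poly_Mapping.single k a) (take i ws) * word (Poly_Mapping.single l b) (drop i ws) =
          (if us = take i ws \<and> vs = drop i ws then a * b else 0)"
        by (simp add: k l lookup_single when_def)
      then show "word (Poly_Mapping.single k a) (take i ws) * word (Poly_Mapping.single l b) (drop i ws) =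
          (if i = length us then (if us @ vs = ws then a * b else 0) else 0)"
        unfolding iff by simp
    qed simp
    also have "\<dots> = (if us @ vs = ws then a * b else 0)" by auto
    finally show ?case by (simp add: mult_single lookup_single k l plus_free_mon_def when_def)
  qed (simp add: lookup_add distrib_left sum.distrib)
qed (simp add: lookup_add distrib_right sum.distrib)

text \<open>The model algebra with a unit adjoined: \<open>a\<close> is the scalar part and
  \<open>x1\<close>, \<open>x2\<close>, \<open>x3\<close> are the coordinates in the model
  algebra.\<close>

definition alg_elt :: "'a::field \<Rightarrow> 'a \<Rightarrow> 'a \<Rightarrow> 'a \<Rightarrow> 'a \<Rightarrow> 'a \<Rightarrow> 'a \<Rightarrow> 'a \<Rightarrow> 'a mat" where
  "alg_elt b11 b12 b21 b22 a x1 x2 x3 = mat_of_rows_list 4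
     [[a, x1, x2, x3], [0, a, 0, b11 * x1 + b12 * x2], [0, 0, a, b21 * x1 + b22 * x2], [0, 0, 0, a]]"

lemma alg_elt_carrier [simp]: "alg_elt b11 b12 b21 b22 a x1 x2 x3 \<in> carrier_mat 4 4"
  by (simp add: alg_elt_def)

lemma alg_elt_mult:
  "alg_elt b11 b12 b21 b22 a x1 x2 x3 * alg_elt b11 b12 b21 b22 a' y1 y2 y3 =
   alg_elt b11 b12 b21 b22 (a * a') (a * y1 + x1 * a') (a * y2 + x2 * a')
     (a * y3 + x1 * (b11 * y1 + b12 * y2) + x2 * (b21 * y1 + b22 * y2) + x3 * a')"
proof (rule eq_mat_4I)
  fix i j :: nat assume ij: "i \<in> {0, 1, 2, 3}" "j \<in> {0, 1, 2, 3}"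
  then have "i < 4" "j < 4" by auto
  with ij show "(alg_elt b11 b12 b21 b22 a x1 x2 x3 * alg_elt b11 b12 b21 b22 a' y1 y2 y3) $$ (i, j) =
    alg_elt b11 b12 b21 b22 (a * a') (a * y1 + x1 * a') (a * y2 + x2 * a')
     (a * y3 + x1 * (b11 * y1 + b12 * y2) + x2 * (b21 * y1 + b22 * y2) + x3 * a') $$ (i, j)"
    unfolding mult_4_index[OF alg_elt_carrier alg_elt_carrier \<open>i < 4\<close> \<open>j < 4\<close>]
    by (auto simp: alg_elt_def algebra_simps)
qed (simp_all add: mult_carrier_mat[OF alg_elt_carrier alg_elt_carrier])

lemma alg_elt_add:
  "alg_elt b11 b12 b21 b22 a x1 x2 x3 + alg_elt b11 b12 b21 b22 a' y1 y2 y3 =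
   alg_elt b11 b12 b21 b22 (a + a') (x1 + y1) (x2 + y2) (x3 + y3)"
  by (rule eq_mat_4I) (auto simp: alg_elt_def algebra_simps)

lemma alg_elt_smult:
  "c \<cdot>\<^sub>m alg_elt b11 b12 b21 b22 a x1 x2 x3 = alg_elt b11 b12 b21 b22 (c * a) (c * x1) (c * x2) (c * x3)"
  by (rule eq_mat_4I) (auto simp: alg_elt_def algebra_simps)

lemma alg_elt_one: "alg_elt b11 b12 b21 b22 1 0 0 0 = 1\<^sub>m 4"
  by (rule eq_mat_4I) (auto simp: alg_elt_def)

lemma alg_elt_eq_0: "alg_elt b11 b12 b21 b22 a x1 x2 x3 = 0\<^sub>m 4 4 \<longleftrightarrow> a = 0 \<and> x1 = 0 \<and> x2 = 0 \<and> x3 = 0"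
proof
  assume eq: "alg_elt b11 b12 b21 b22 a x1 x2 x3 = 0\<^sub>m 4 4"
  have "alg_elt b11 b12 b21 b22 a x1 x2 x3 $$ (i, j) = 0\<^sub>m 4 4 $$ (i, j)" for i j
    using eq by simp
  from this[of 0 0] this[of 0 1] this[of 0 2] this[of 0 3]
  show "a = 0 \<and> x1 = 0 \<and> x2 = 0 \<and> x3 = 0" by (simp add: alg_elt_def)
qed (auto intro!: eq_mat_4I simp: alg_elt_def)

lemma alg_of_form_group:
  "alg_of 3 (form_group b11 b12 b21 b22) = {alg_elt b11 b12 b21 b22 a x1 x2 x3 | a x1 x2 x3. True}"
proof -
  have *: "alg_mat (form_mul b11 b12 b21 b22) (x1, x2, x3) = alg_elt b11 b12 b21 b22 1 x1 x2 x3" for x1 x2 x3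
    by (simp add: alg_mat_form_mul alg_elt_def)
  have elt: "\<alpha> \<cdot>\<^sub>m 1\<^sub>m (3 + 1) + \<beta> \<cdot>\<^sub>m alg_mat (form_mul b11 b12 b21 b22) (x1, x2, x3) =
      alg_elt b11 b12 b21 b22 (\<alpha> + \<beta>) (\<beta> * x1) (\<beta> * x2) (\<beta> * x3)" for \<alpha> \<beta> x1 x2 x3
    using alg_elt_one[of b11 b12 b21 b22, symmetric] by (simp add: * alg_elt_smult alg_elt_add)
  show ?thesis
  proof (intro equalityI subsetI)
    fix A assume "A \<in> alg_of 3 (form_group b11 b12 b21 b22)"
    then obtain \<alpha> \<beta> x where "A = \<alpha> \<cdot>\<^sub>m 1\<^sub>m (3 + 1) + \<beta> \<cdot>\<^sub>m alg_mat (form_mul b11 b12 b21 b22) x"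
      unfolding alg_of_def form_group_def by blast
    then show "A \<in> {alg_elt b11 b12 b21 b22 a x1 x2 x3 | a x1 x2 x3. True}"
      by (cases x) (use elt in blast)
  next
    fix A assume "A \<in> {alg_elt b11 b12 b21 b22 a x1 x2 x3 | a x1 x2 x3. True}"
    then obtain a x1 x2 x3 where "A = alg_elt b11 b12 b21 b22 a x1 x2 x3" by blast
    then have "A = (a - 1) \<cdot>\<^sub>m 1\<^sub>m (3 + 1) + 1 \<cdot>\<^sub>m alg_mat (form_mul b11 b12 b21 b22) (x1, x2, x3)"
      unfolding elt by simp
    then show "A \<in> alg_of 3 (form_group b11 b12 b21 b22)"
      unfolding alg_of_def form_group_def by blast
  qed
qed

text \<open>The product of the generators number \<open>i\<close> and \<open>j\<close> evaluates to \<open>b\<^sub>i\<^sub>j E\<^sub>1\<^sub>4\<close>. As words of length three evaluate to \<open>0\<close>, only words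
  of length at most two contribute.\<close>

definition eval_alg :: "'a::field \<Rightarrow> 'a \<Rightarrow> 'a \<Rightarrow> 'a \<Rightarrow> (two_gens, 'a) free_alg \<Rightarrow> 'a mat" where
  "eval_alg b11 b12 b21 b22 p = alg_elt b11 b12 b21 b22 (word p []) (word p [T1]) (word p [T2])
     (b11 * word p [T1, T1] + b12 * word p [T1, T2] + b21 * word p [T2, T1] + b22 * word p [T2, T2])"

text \<open>Words of length at most two split only into such words, and cutting a word of length two
  in the middle yields the bilinear term of the matrix product.\<close>

lemma eval_alg_mult:
  "eval_alg b11 b12 b21 b22 (p * q) = eval_alg b11 b12 b21 b22 p * eval_alg b11 b12 b21 b22 q"
  unfolding eval_alg_def alg_elt_mult word_mult
  by (simp add: numeral_2_eq_2 algebra_simps)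

lemma eval_alg_add:
  "eval_alg b11 b12 b21 b22 (p + q) = eval_alg b11 b12 b21 b22 p + eval_alg b11 b12 b21 b22 q"
  unfolding eval_alg_def alg_elt_add by (simp add: lookup_add algebra_simps)

lemma eval_alg_scal: "eval_alg b11 b12 b21 b22 (scal c) = alg_elt b11 b12 b21 b22 c 0 0 0"
  by (simp add: eval_alg_def scal_def lookup_single zero_free_mon_def when_def)

lemma eval_alg_one: "eval_alg b11 b12 b21 b22 1 = 1\<^sub>m 4"
  using eval_alg_scal[of b11 b12 b21 b22 1] by (simp add: scal_simps alg_elt_one)

lemma eval_alg_gen:
  "eval_alg b11 b12 b21 b22 t1 = alg_elt b11 b12 b21 b22 0 1 0 0"
  "eval_alg b11 b12 b21 b22 t2 = alg_elt b11 b12 b21 b22 0 0 1 0"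
  by (simp_all add: eval_alg_def gen_def lookup_single when_def)

lemma eval_alg_scal_mult: "eval_alg b11 b12 b21 b22 (scal c * p) = c \<cdot>\<^sub>m eval_alg b11 b12 b21 b22 p"
  unfolding eval_alg_mult eval_alg_scal by (simp add: eval_alg_def alg_elt_mult alg_elt_smult)

lemma eval_alg_uminus: "eval_alg b11 b12 b21 b22 (- p) = (- 1) \<cdot>\<^sub>m eval_alg b11 b12 b21 b22 p"
  using eval_alg_scal_mult[of b11 b12 b21 b22 "- 1" p] by (simp add: scal_simps)

lemma eval_alg_diff:
  "eval_alg b11 b12 b21 b22 (p - q) = eval_alg b11 b12 b21 b22 p + (- 1) \<cdot>\<^sub>m eval_alg b11 b12 b21 b22 q"
  using eval_alg_add[of b11 b12 b21 b22 p "- q"] by (simp add: eval_alg_uminus)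

lemma ring_class_ring: "ring (class_ring :: 'a::ring_1 ring)"
  by (rule class_ring.ring_axioms)

lemma eval_alg_ring_hom:
  "ring_hom_ring (class_ring :: (two_gens, 'a::field) free_alg ring) (ring_mat TYPE('a) 4 ()) (eval_alg b11 b12 b21 b22)"
  by (rule ring_hom_ringI[OF ring_class_ring ring_mat])
    (simp_all add: ring_mat_simps eval_alg_mult eval_alg_add eval_alg_one, simp add: eval_alg_def)

lemma mem_kernel_eval_alg:
  "p \<in> a_kernel class_ring (ring_mat TYPE('a::field) 4 ()) (eval_alg b11 b12 b21 b22) \<longleftrightarrow>
    eval_alg b11 b12 b21 b22 p = 0\<^sub>m 4 4"
  unfolding a_kernel_def' ring_mat_simps by simp

lemma eval_alg_carrier: "eval_alg b11 b12 b21 b22 p \<in> carrier_mat 4 4"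
  by (simp add: eval_alg_def)

lemma range_eval_alg:
  assumes "eval_alg b11 b12 b21 b22 z = alg_elt b11 b12 b21 b22 0 0 0 1"
  shows "range (eval_alg b11 b12 b21 b22) = alg_of 3 (form_group b11 b12 b21 b22)"
  unfolding alg_of_form_group
proof (intro equalityI subsetI)
  fix A assume "A \<in> range (eval_alg b11 b12 b21 b22)"
  then show "A \<in> {alg_elt b11 b12 b21 b22 a x1 x2 x3 | a x1 x2 x3. True}"
    unfolding eval_alg_def by blast
next
  fix A assume "A \<in> {alg_elt b11 b12 b21 b22 a x1 x2 x3 | a x1 x2 x3. True}"
  then obtain a x1 x2 x3 where "A = alg_elt b11 b12 b21 b22 a x1 x2 x3" by blast
  also have "\<dots> = eval_alg b11 b12 b21 b22 (scal a + scal x1 * t1 + scal x2 * t2 + scal x3 * z)"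
    by (simp add: eval_alg_add eval_alg_scal_mult eval_alg_scal eval_alg_gen assms alg_elt_smult alg_elt_add)
  finally show "A \<in> range (eval_alg b11 b12 b21 b22)" by simp
qed

section \<open>Ideals of the free algebra and reduction to normal forms\<close>

lemma class_ring_coset: "I +>\<^bsub>class_ring\<^esub> p = (\<lambda>i. i + p) ` I"
  by (auto simp: a_r_coset_def')

locale free_alg_ideal =
  fixes I :: "('g, 'a::field) free_alg set"
  assumes ideal: "ideal I class_ring"
begin

lemma add: "p \<in> I \<Longrightarrow> q \<in> I \<Longrightarrow> p + q \<in> I"
  using additive_subgroup.a_closed[OF ideal.axioms(1)[OF ideal]] by simp

lemma mult_left: "p \<in> I \<Longrightarrow> q * p \<in> I"
  using ideal.I_l_closed[OF ideal, of p q] by simp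

lemma mult_right: "p \<in> I \<Longrightarrow> p * q \<in> I"
  using ideal.I_r_closed[OF ideal, of p q] by simp

lemma zero: "0 \<in> I"
  using additive_subgroup.zero_closed[OF ideal.axioms(1)[OF ideal]] by simp

lemma uminus: "p \<in> I \<Longrightarrow> - p \<in> I"
  using mult_left[of p "- 1"] by simp

lemma diff: "p \<in> I \<Longrightarrow> q \<in> I \<Longrightarrow> p - q \<in> I"
  using add[of p "- q"] uminus by simp

end

definition form_coeff :: "'a \<Rightarrow> 'a \<Rightarrow> 'a \<Rightarrow> 'a \<Rightarrow> two_gens \<Rightarrow> two_gens \<Rightarrow> 'a" where
  "form_coeff b11 b12 b21 b22 g h = (case g of
     T1 \<Rightarrow> (case h of T1 \<Rightarrow> b11 | T2 \<Rightarrow> b12) | T2 \<Rightarrow> (case h of T1 \<Rightarrow> b21 | T2 \<Rightarrow> b22))"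

text \<open>Modulo the ideal, \<open>rel\<close> turns words of length two into multiples of
  \<open>z\<close>, and \<open>ann\<close> removes longer words. Everything reduces to the span of
  1, \<open>t1\<close>, \<open>t2\<close>, \<open>z\<close>, on which evaluation is injective; so
  the kernel is exactly the ideal, and the quotient is isomorphic to the image.\<close>

lemma has_presentation_form_group:
  fixes b11 b12 b21 b22 :: "'a::field" and S :: "(two_gens, 'a) free_alg set"
  assumes S: "\<And>p. p \<in> S \<Longrightarrow> eval_alg b11 b12 b21 b22 p = 0\<^sub>m 4 4"
    and z: "eval_alg b11 b12 b21 b22 z = alg_elt b11 b12 b21 b22 0 0 0 1"
    and rel: "\<And>I g h. free_alg_ideal I \<Longrightarrow> S \<subseteq> I \<Longrightarrow> gen g * gen h - scal (form_coeff b11 b12 b21 b22 g h) * z \<in> I"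
    and ann: "\<And>I g. free_alg_ideal I \<Longrightarrow> S \<subseteq> I \<Longrightarrow> z * gen g \<in> I"
  shows "has_presentation 4 (alg_of 3 (form_group b11 b12 b21 b22)) S"
proof -
  let ?R = "class_ring :: (two_gens, 'a) free_alg ring" and ?M = "ring_mat TYPE('a) 4 ()"
  let ?f = "eval_alg b11 b12 b21 b22"
  interpret H: ring_hom_ring ?R ?M ?f by (rule eval_alg_ring_hom)
  define I where "I = genideal ?R S"
  have idl: "ideal I ?R" unfolding I_def by (rule ring.genideal_ideal[OF ring_class_ring]) simp
  have SI: "S \<subseteq> I" unfolding I_def by (rule ring.genideal_self[OF ring_class_ring]) simp
  interpret I: free_alg_ideal I by (rule free_alg_ideal.intro[OF idl])
  \<comment> \<open>The normal form uses the same four coefficients as \<open>eval_alg\<close>;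
    hence it is 0 for elements of the kernel, and \<open>p - nf p\<close> in \<open>I\<close> puts
    them into the ideal.\<close>
  define nf where "nf p = scal (word p []) + scal (word p [T1]) * t1 + scal (word p [T2]) * t2 +
    scal (b11 * word p [T1, T1] + b12 * word p [T1, T2] + b21 * word p [T2, T1] + b22 * word p [T2, T2]) * z"
    for p :: "(two_gens, 'a) free_alg"
  have nf_add: "nf (p + q) = nf p + nf q" for p q
    by (simp add: nf_def lookup_add distrib_left scal_simps distrib_right algebra_simps)
  have nf: "p - nf p \<in> I" for p
  proof (induction p rule: poly_mapping_single_add_induct)
    case (add p q)
    have "p + q - nf (p + q) = (p - nf p) + (q - nf q)" by (simp add: nf_add)
    then show ?case by (simp only: I.add[OF add])
  next
    case (single k c)
    obtain ws where k: "k = FreeMon ws" by (metis free_mon.exhaust)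
    have gens: "Poly_Mapping.single (FreeMon (g # ws)) 1 = gen g * Poly_Mapping.single (FreeMon ws) 1" for g :: two_gens and ws
      by (simp add: gen_def mult_single plus_free_mon_def)
    have one: "Poly_Mapping.single (FreeMon []) 1 = (1 :: (two_gens, 'a) free_alg)"
      by (simp add: zero_free_mon_def[symmetric])
    have c: "Poly_Mapping.single k c = scal c * Poly_Mapping.single k 1"
      by (simp add: scal_mult)
    consider "ws = []" | g where "ws = [g]" | g h where "ws = [g, h]" | g h l us where "ws = g # h # l # us"
      by (metis list.exhaust)
    then show ?case
    proof cases
      case 1
      have "nf (Poly_Mapping.single k c) = Poly_Mapping.single k c"
        by (simp add: nf_def k 1 lookup_single scal_simps when_def) (simp add: scal_def zero_free_mon_def)
      then show ?thesis using I.zero by simp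
    next
      case (2 g)
      have "nf (Poly_Mapping.single k c) = Poly_Mapping.single k c"
        by (cases g) (simp_all add: nf_def k 2 lookup_single scal_simps when_def gen_def scal_mult)
      then show ?thesis using I.zero by simp
    next
      case (3 g h)
      have "nf (Poly_Mapping.single k c) = scal c * (scal (form_coeff b11 b12 b21 b22 g h) * z)"
        by (cases g; cases h)
          (simp_all add: nf_def k 3 lookup_single scal_simps when_def form_coeff_def mult.commute
            flip: mult.assoc)
      moreover have "Poly_Mapping.single k c = scal c * (gen g * gen h)"
        unfolding c by (simp add: k 3 gens one)
      ultimately have "Poly_Mapping.single k c - nf (Poly_Mapping.single k c) =
          scal c * (gen g * gen h - scal (form_coeff b11 b12 b21 b22 g h) * z)"
        by (simp add: right_diff_distrib)
      then show ?thesis using I.mult_left[OF rel[OF I.free_alg_ideal_axioms SI]] by simp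
    next
      case (4 g h l us)
      have "nf (Poly_Mapping.single k c) = 0"
        by (simp add: nf_def k 4 lookup_single scal_simps)
      \<comment> \<open>The first three letters already lie in the ideal; the remaining ones are
        only a right factor.\<close>
      moreover have "gen g * gen h * gen l = (gen g * gen h - scal (form_coeff b11 b12 b21 b22 g h) * z) * gen l +
          scal (form_coeff b11 b12 b21 b22 g h) * (z * gen l)"
        by (simp add: algebra_simps)
      then have "gen g * gen h * gen l \<in> I"
        using I.add[OF I.mult_right[OF rel[OF I.free_alg_ideal_axioms SI]] I.mult_left[OF ann[OF I.free_alg_ideal_axioms SI]]]
        by simp
      then have "scal c * (gen g * gen h * gen l * Poly_Mapping.single (FreeMon us) 1) \<in> I"
        by (rule I.mult_left[OF I.mult_right])
      moreover have "Poly_Mapping.single k c = scal c * (gen g * gen h * gen l * Poly_Mapping.single (FreeMon us) 1)"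
        unfolding c by (simp add: k 4 gens mult.assoc)
      ultimately show ?thesis by simp
    qed
  qed
  have mem_ker: "p \<in> a_kernel ?R ?M ?f \<longleftrightarrow> ?f p = 0\<^sub>m 4 4" for p
    by (rule mem_kernel_eval_alg)
  have ker: "a_kernel ?R ?M ?f = I"
  proof
    have "ideal (a_kernel ?R ?M ?f) ?R" by (rule H.kernel_is_ideal)
    moreover have "S \<subseteq> a_kernel ?R ?M ?f" by (rule subsetI) (simp only: mem_ker S)
    ultimately show "I \<subseteq> a_kernel ?R ?M ?f" unfolding I_def by (rule ring.genideal_minimal[OF ring_class_ring])
    show "a_kernel ?R ?M ?f \<subseteq> I"
    proof
      fix p assume "p \<in> a_kernel ?R ?M ?f"
      then have "?f p = 0\<^sub>m 4 4" by (simp only: mem_ker)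
      then have "nf p = 0" unfolding eval_alg_def alg_elt_eq_0 by (simp add: nf_def scal_simps)
      then show "p \<in> I" using nf[of p] by simp
    qed
  qed
  have img: "?f ` carrier ?R = alg_of 3 (form_group b11 b12 b21 b22)"
    unfolding class_ring_simps by (rule range_eval_alg[OF z])
  let ?F = "\<lambda>X. the_elem (?f ` X)"
  have iso: "?F \<in> ring_iso (?R Quot I) (?M\<lparr>carrier := alg_of 3 (form_group b11 b12 b21 b22)\<rparr>)"
    using H.FactRing_iso_set_aux unfolding ker img .
  \<comment> \<open>The isomorphism is given on cosets as sets; its value at a representative is
    needed for linearity.\<close>
  have F: "?F (I +>\<^bsub>?R\<^esub> p) = ?f p" for p
  proof -
    have "?f (i + p) = ?f p" if "i \<in> I" for i
    proof -
      have "?f i = 0\<^sub>m 4 4" using mem_ker[of i] that unfolding ker by simp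
      then show ?thesis unfolding eval_alg_add
        by (simp only: left_add_zero_mat[of "?f p" 4 4] eval_alg_carrier)
    qed
    then have "?f ` (I +>\<^bsub>?R\<^esub> p) = (\<lambda>i. ?f p) ` I"
      unfolding class_ring_coset image_image by (rule image_cong[OF refl])
    also have "\<dots> = {?f p}" using I.zero by (rule image_constant)
    finally show ?thesis by (simp only: the_elem_eq)
  qed
  show ?thesis
    unfolding has_presentation_def Let_def I_def[symmetric]
    by (rule bexI[OF _ iso]) (simp add: F eval_alg_scal_mult)
qed

section \<open>The three presentations, with \<open>z\<close> a product of two generators whose Gram
  coefficient is 1\<close>

lemma presentation_N1: "has_presentation 4 (alg_of 3 (N1 :: 'a::field mat set)) {t1 ^ 2, t2 ^ 2, t1 * t2}"
  unfolding N_eq_form_group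
proof (rule has_presentation_form_group[where z = "t2 * t1"])
  fix I :: "(two_gens, 'a) free_alg set" and g h
  assume "free_alg_ideal I" and S: "{t1 ^ 2, t2 ^ 2, t1 * t2} \<subseteq> I"
  then interpret free_alg_ideal I by simp
  have r: "t1 * t1 \<in> I" "t2 * t2 \<in> I" "t1 * t2 \<in> I" using S by (simp_all add: power2_eq_square)
  show "gen g * gen h - scal (form_coeff 0 0 1 0 g h) * (t2 * t1) \<in> I"
    using r zero by (cases g; cases h) (simp_all add: form_coeff_def scal_simps)
  show "t2 * t1 * gen g \<in> I"
    using mult_left[OF r(1), of t2] mult_left[OF r(3), of t2] by (cases g) (simp_all add: mult.assoc)
qed (auto simp: power2_eq_square eval_alg_mult eval_alg_gen alg_elt_mult alg_elt_eq_0)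

lemma presentation_N2: "has_presentation 4 (alg_of 3 (N2 :: 'a::field mat set)) {t1 ^ 2, t2 ^ 2, t1 * t2 + t2 * t1}"
  unfolding N_eq_form_group
proof (rule has_presentation_form_group[where z = "t2 * t1"])
  fix I :: "(two_gens, 'a) free_alg set" and g h
  assume "free_alg_ideal I" and S: "{t1 ^ 2, t2 ^ 2, t1 * t2 + t2 * t1} \<subseteq> I"
  then interpret free_alg_ideal I by simp
  have r: "t1 * t1 \<in> I" "t2 * t2 \<in> I" "t1 * t2 + t2 * t1 \<in> I" using S by (simp_all add: power2_eq_square)
  show "gen g * gen h - scal (form_coeff 0 (- 1) 1 0 g h) * (t2 * t1) \<in> I"
    using r zero by (cases g; cases h) (simp_all add: form_coeff_def scal_simps)
  \<comment> \<open>Anticommuting the first two letters brings the two factors \<open>t2\<close>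
    together.\<close>
  have "t2 * t1 * t2 = (t1 * t2 + t2 * t1) * t2 - t1 * (t2 * t2 :: (two_gens, 'a) free_alg)"
    by (simp add: algebra_simps)
  then have "t2 * t1 * t2 \<in> I" using diff[OF mult_right[OF r(3)] mult_left[OF r(2)]] by simp
  then show "t2 * t1 * gen g \<in> I"
    using mult_left[OF r(1), of t2] by (cases g) (simp_all add: mult.assoc)
qed (auto simp: power2_eq_square eval_alg_mult eval_alg_add eval_alg_gen alg_elt_mult alg_elt_add alg_elt_eq_0)

lemma presentation_N3:
  assumes "l \<noteq> 0"
  shows "has_presentation 4 (alg_of 3 (N3 (l :: 'a::field))) {t2 ^ 2 - scal l * t1 ^ 2, t2 * t1, t1 ^ 2 - t1 * t2}"
  unfolding N_eq_form_group
proof (rule has_presentation_form_group[where z = "t1 * t1"])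
  fix I :: "(two_gens, 'a) free_alg set" and g h
  assume "free_alg_ideal I" and S: "{t2 ^ 2 - scal l * t1 ^ 2, t2 * t1, t1 ^ 2 - t1 * t2} \<subseteq> I"
  then interpret free_alg_ideal I by simp
  have r: "t2 * t2 - scal l * (t1 * t1) \<in> I" "t2 * t1 \<in> I" "t1 * t1 - t1 * t2 \<in> I"
    using S by (simp_all add: power2_eq_square)
  have r': "t1 * t2 - t1 * t1 \<in> I" using uminus[OF r(3)] by simp
  show "gen g * gen h - scal (form_coeff 1 1 0 l g h) * (t1 * t1) \<in> I"
    using r r' zero by (cases g; cases h) (simp_all add: form_coeff_def scal_simps)
  have "scal l * (t1 * t1 * t2) = t2 * (t2 * t2 - scal l * (t1 * t1)) - (t2 * t2 - scal l * (t1 * t1)) * t2 +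
      scal l * (t2 * t1 * t1)"
    unfolding right_diff_distrib left_diff_distrib mult.assoc
    by (simp add: mult.assoc[symmetric] scal_central[symmetric])
  then have "scal l * (t1 * t1 * t2) \<in> I"
    using add[OF diff[OF mult_left[OF r(1)] mult_right[OF r(1)]] mult_left[OF mult_right[OF r(2)]]] by simp
  then have "scal (inverse l) * (scal l * (t1 * t1 * t2)) \<in> I" by (rule mult_left)
  then have z2: "t1 * t1 * t2 \<in> I"
    using assms by (simp add: mult.assoc[symmetric] scal_simps)
  have "t1 * t1 * t1 = t1 * (t1 * t1 - t1 * t2) + t1 * t1 * (t2 :: (two_gens, 'a) free_alg)"
    by (simp add: algebra_simps)
  then have z1: "t1 * t1 * t1 \<in> I" using add[OF mult_left[OF r(3)] z2] by simp
  show "t1 * t1 * gen g \<in> I"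
    using z1 z2 by (cases g) simp_all
qed (auto simp: power2_eq_square eval_alg_mult eval_alg_diff eval_alg_scal eval_alg_gen alg_elt_mult alg_elt_add
    alg_elt_smult alg_elt_eq_0)

theorem lemma7p3:
  shows "(\<forall>U :: 'a::field mat set.
      regular 3 U \<and> delta_linear 3 U \<and> max_deg 3 (center 3 U) = 2 \<and> max_rank 3 (center 3 U) = 1 \<longrightarrow>
        (abelian 3 U \<longrightarrow> U = translation_subgroup 3) \<and>
        (\<not> abelian 3 U \<longrightarrow>
          (\<exists>!M. M \<in> {N1, N2} \<union> {N3 l | l. l \<noteq> 0} \<and> AGL_conj 3 U M) \<and>
          (AGL_conj 3 U N1 \<longleftrightarrow> fix_dim 3 U = 2) \<and>
          (AGL_conj 3 U N2 \<longleftrightarrow> fix_dim 3 U = 1 \<and> max_deg 3 U = 2 \<and> CHAR('a) \<noteq> 2) \<and>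
          ((\<exists>l. l \<noteq> 0 \<and> AGL_conj 3 U (N3 l)) \<longleftrightarrow> fix_dim 3 U = 1 \<and> max_deg 3 U = 3)))
    \<and> has_presentation 4 (alg_of 3 (N1 :: 'a mat set)) {t1 ^ 2, t2 ^ 2, t1 * t2}
    \<and> has_presentation 4 (alg_of 3 (N2 :: 'a mat set)) {t1 ^ 2, t2 ^ 2, t1 * t2 + t2 * t1}
    \<and> (\<forall>l :: 'a. l \<noteq> 0 \<longrightarrow>
        has_presentation 4 (alg_of 3 (N3 l)) {t2 ^ 2 - scal l * t1 ^ 2, t2 * t1, t1 ^ 2 - t1 * t2})"
proof (intro conjI allI impI)
  fix U :: "'a mat set"
  assume "regular 3 U \<and> delta_linear 3 U \<and> max_deg 3 (center 3 U) = 2 \<and> max_rank 3 (center 3 U) = 1"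
  then have "regular 3 U" "delta_linear 3 U" "max_rank 3 (center 3 U) = 1" by auto
  note cl = classification[OF this]
  {
    assume "abelian 3 U"
    then show "U = translation_subgroup 3" by (rule cl(1))
  }
  assume na: "\<not> abelian 3 U"
  show "\<exists>!M. M \<in> {N1, N2} \<union> {N3 l | l. l \<noteq> 0} \<and> AGL_conj 3 U M"
    by (rule cl(2)[OF na])
  show "AGL_conj 3 U N1 \<longleftrightarrow> fix_dim 3 U = 2"
    by (rule cl(3)[OF na])
  show "AGL_conj 3 U N2 \<longleftrightarrow> fix_dim 3 U = 1 \<and> max_deg 3 U = 2 \<and> CHAR('a) \<noteq> 2"
    by (rule cl(4)[OF na])
  show "(\<exists>l. l \<noteq> 0 \<and> AGL_conj 3 U (N3 l)) \<longleftrightarrow> fix_dim 3 U = 1 \<and> max_deg 3 U = 3"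
    by (rule cl(5)[OF na])
qed (simp_all add: presentation_N1 presentation_N2 presentation_N3)

end
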